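(* Let $p>1$ and let $V\in C^1(\mathbb R^n)$ be positive definite, proper, and $p$-homogeneous. For an integer $m\ge1$ and parameters $A\in\mathbb R^{m\times n}$, $b,w\in\mathbb R^m$, let $\widehat V=\widehat V_{A,b,w}:\mathbb R^n\to\mathbb R$ be defined by $$\widehat V(0)=0,\qquad \widehat V(ru)=r^p\exp\!\left(w^\top\tanh(Au+b)\right)\quad (r>0,\ \|u\|=1),$$ where $\tanh$ acts componentwise. For every $\varepsilon>0$, there exist an integer $m\ge1$ and parameters $(A,b,w)$ such that $$\sup_{\|u\|=1}\left(|\widehat V(u)-V(u)|+\|D\widehat V(u)-DV(u)\|\right)<\varepsilon .$$ For every integer $m\ge1$ and all parameters $A\in\mathbb R^{m\times n}$, $b,w\in\mathbb R^m$, the function $\widehat V_{A,b,w}$ is positive definite, proper, and $p$-homogeneous; it belongs to $C^1(\mathbb R^n)\cap C^\infty(\mathbb R^n\setminus\{0\})$ and has the origin as its unique zero. Moreover, if for some $\mu>0$ $$DV(x)f_d(x)\le-\mu\|x\|^{p+d-1},\qquad x\ne0,$$ then the parameters can be chosen so that also $$D\widehat V(x)f_d(x)\le-\frac{\mu}{2}\|x\|^{p+d-1},\qquad x\ne0 .$$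
   Context: A map $g:\mathbb R^n\to\mathbb R^m$ is homogeneous of degree $s\in\mathbb R$ ($s$-homogeneous) if $g(rx)=r^sg(x)$ for every $x\in\mathbb R^n$ and $r>0$. A function is proper if its sublevel sets are compact, and positive definite if it vanishes at $0$ and is positive elsewhere. $\|\cdot\|$ is the Euclidean norm for vectors and the induced operator norm for linear maps. $f_d:\mathbb R^n\to\mathbb R^n$ is a continuous $d$-homogeneous vector field, with $d\ge1$ real, such that the origin of $\dot x=f_d(x)$ is locally asymptotically stable. *)

theory Defs
  imports "HOL-Analysis.Analysis"
begin

definition homogeneous :: "real \<Rightarrow> ('a::real_vector \<Rightarrow> 'b::real_vector) \<Rightarrow> bool" where
  "homogeneous s g \<longleftrightarrow> (\<forall>x. \<forall>r>0. g (r *\<^sub>R x) = (r powr s) *\<^sub>R g x)"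

definition positive_definite :: "('a::zero \<Rightarrow> real) \<Rightarrow> bool" where
  "positive_definite f \<longleftrightarrow> f 0 = 0 \<and> (\<forall>x. x \<noteq> 0 \<longrightarrow> 0 < f x)"

definition proper_fun :: "('a::topological_space \<Rightarrow> real) \<Rightarrow> bool" where
  "proper_fun f \<longleftrightarrow> (\<forall>c. compact {x. f x \<le> c})"

(* Intended for open S: the derivatives are taken in the full space.  On a Euclidean
   space, continuity of all directional derivatives (in the base point) is the same as
   continuity of the derivative in operator norm. *)
primrec Ck_on :: "nat \<Rightarrow> 'a::euclidean_space set \<Rightarrow> ('a \<Rightarrow> 'b::real_normed_vector) \<Rightarrow> bool" where
  "Ck_on 0 S f \<longleftrightarrow> continuous_on S f"
| "Ck_on (Suc k) S f \<longleftrightarrow>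
     (\<forall>x\<in>S. f differentiable (at x)) \<and>
     (\<forall>v. Ck_on k S (\<lambda>x. frechet_derivative f (at x) v))"

definition smooth_on :: "'a::euclidean_space set \<Rightarrow> ('a \<Rightarrow> 'b::real_normed_vector) \<Rightarrow> bool" where
  "smooth_on S f \<longleftrightarrow> (\<forall>k. Ck_on k S f)"

definition solution_on ::
    "real set \<Rightarrow> ('a::real_normed_vector \<Rightarrow> 'a) \<Rightarrow> (real \<Rightarrow> 'a) \<Rightarrow> bool" where
  "solution_on I f x \<longleftrightarrow> (\<forall>t\<in>I. (x has_vector_derivative f (x t)) (at t within I))"

(* The vector field is only continuous, so solutions need not be unique and both
   conditions range over all solutions.  Solutions on every interval [0,T) are covered by
   the stability condition; it keeps solutions starting near the origin bounded, so they
   extend to [0,\<infinity>), and attractivity only has to speak about solutions on [0,\<infinity>). *)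
definition lyapunov_stable :: "('a::real_normed_vector \<Rightarrow> 'a) \<Rightarrow> bool" where
  "lyapunov_stable f \<longleftrightarrow>
     (\<forall>e>0. \<exists>\<delta>>0. \<forall>T>0. \<forall>x. solution_on {0..<T} f x \<and> norm (x 0) < \<delta> \<longrightarrow>
        (\<forall>t\<in>{0..<T}. norm (x t) < e))"

definition locally_attractive :: "('a::real_normed_vector \<Rightarrow> 'a) \<Rightarrow> bool" where
  "locally_attractive f \<longleftrightarrow>
     (\<exists>\<delta>>0. \<forall>x. solution_on {0..} f x \<and> norm (x 0) < \<delta> \<longrightarrow> (x \<longlongrightarrow> 0) at_top)"

definition locally_asymptotically_stable :: "('a::real_normed_vector \<Rightarrow> 'a) \<Rightarrow> bool" where
  "locally_asymptotically_stable f \<longleftrightarrow> lyapunov_stable f \<and> locally_attractive f"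

(* A i is the i-th row of the m x n weight matrix; only the entries with i < m of A, b
   and w are used. *)
definition Vhat :: "real \<Rightarrow> nat \<Rightarrow> (nat \<Rightarrow> real^'n) \<Rightarrow> (nat \<Rightarrow> real) \<Rightarrow> (nat \<Rightarrow> real) \<Rightarrow>
    real^'n \<Rightarrow> real" where
  "Vhat p m A b w x =
     (if x = 0 then 0
      else norm x powr p * exp (\<Sum>i<m. w i * tanh (A i \<bullet> (x /\<^sub>R norm x) + b i)))"

lemma Vhat_zero: "Vhat p m A b w 0 = 0"
  by (simp add: Vhat_def)

lemma Vhat_polar:
  assumes "r > 0" and "norm u = 1"
  shows "Vhat p m A b w (r *\<^sub>R u) = r powr p * exp (\<Sum>i<m. w i * tanh (A i \<bullet> u + b i))"
proof -
  have "u \<noteq> 0" using assms(2) by auto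
  then show ?thesis using assms by (simp add: Vhat_def)
qed

(* The supremum is taken in the extended reals, so that the bound includes finiteness. *)
definition C1_sphere_dist :: "('a::real_normed_vector \<Rightarrow> real) \<Rightarrow> ('a \<Rightarrow> real) \<Rightarrow> ereal" where
  "C1_sphere_dist F G =
     (SUP u\<in>sphere 0 1. ereal (\<bar>F u - G u\<bar> +
        onorm (\<lambda>h. frechet_derivative F (at u) h - frechet_derivative G (at u) h)))"

end

theory Submission
  imports Defs
begin

text \<open>On the unit sphere, \<open>V\<close> and its approximation are \<open>exp N\<close> with \<open>N = ln V\<close> and with \<open>N\<close> a
  \<open>tanh\<close> network, and their derivatives there are continuous expressions in the jet (value and
  gradient) of \<open>N\<close>. It therefore suffices to approximate a \<open>C\<^sup>1\<close> function on a bounded set by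
  networks, uniformly together with the gradient. The closure of the networks contains the functions
  \<open>exp (a \<bullet> x)\<close>, because \<open>exp s\<close> is the rescaled left tail of \<open>tanh\<close>. The span of these
  exponentials is an algebra, and its closure contains the coordinates as the limits of
  \<open>(exp (s * (a \<bullet> x)) - 1) / s\<close>, hence all polynomials; Bernstein operators, applied to one
  coordinate after the other, then give every \<open>C\<^sup>1\<close> function. The decay estimate is
  inherited on the sphere and extends to all \<open>x \<noteq> 0\<close> by homogeneity.\<close>

subsection \<open>Linear spans closed under uniform limits\<close>

text \<open>Uniform approximation of a function says nothing about its gradient, so the
  Stone-Weierstrass theorem for the values alone would not suffice. The objects approximated are
  therefore jets, with limits taken in the product norm on \<open>real \<times> 'a\<close>. Jets
  multiply by the Leibniz rule and not componentwise, so the passage from polynomials to C1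
  functions uses an explicit operator whose derivative can be estimated: the derivative of a
  Bernstein polynomial is again a Bernstein average, now of difference quotients. The detour through
  exponentials is forced by products: a product of \<open>tanh\<close> units is not a
  \<open>tanh\<close> unit, whereas exponents simply add. \<open>lin_closure\<close> contains its
  own limits, so nested limits need no bookkeeping of tolerances. Finite networks reappear only in
  \<open>tanh_closure_net\<close>, by induction over the rules of the closure.\<close>

inductive_set lin_closure :: "'a set \<Rightarrow> ('a \<Rightarrow> 'b::real_normed_vector) set \<Rightarrow> ('a \<Rightarrow> 'b) set"
  for K S where
  base: "F \<in> S \<Longrightarrow> F \<in> lin_closure K S"
| scale: "F \<in> lin_closure K S \<Longrightarrow> (\<lambda>x. c *\<^sub>R F x) \<in> lin_closure K S"
| add: "F \<in> lin_closure K S \<Longrightarrow> G \<in> lin_closure K S \<Longrightarrow> (\<lambda>x. F x + G x) \<in> lin_closure K S"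
| lim: "(\<And>e. e > 0 \<Longrightarrow> \<exists>G. G \<in> lin_closure K S \<and> (\<forall>x\<in>K. norm (F x - G x) < e)) \<Longrightarrow>
    F \<in> lin_closure K S"

lemma lin_closure_subset:
  assumes "S \<subseteq> lin_closure K T"
  shows "lin_closure K S \<subseteq> lin_closure K T"
proof
  fix F assume "F \<in> lin_closure K S"
  then show "F \<in> lin_closure K T"
  proof induction
    case (base F) then show ?case using assms by blast
  next
    case (scale F c) then show ?case by (intro lin_closure.scale)
  next
    case (add F G) then show ?case by (intro lin_closure.add)
  next
    case (lim F)
    show ?case by (rule lin_closure.lim) (use lim in blast)
  qed
qed

lemma lin_closure_diff:
  assumes "F \<in> lin_closure K S" "G \<in> lin_closure K S"
  shows "(\<lambda>x. F x - G x) \<in> lin_closure K S"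
  using lin_closure.add[OF assms(1) lin_closure.scale[OF assms(2), of "-1"]] by simp

lemma lin_closure_sum:
  assumes "finite I" "S \<noteq> {}" "\<And>i. i \<in> I \<Longrightarrow> F i \<in> lin_closure K S"
  shows "(\<lambda>x. \<Sum>i\<in>I. F i x) \<in> lin_closure K S"
  using assms(1,3)
proof (induction I rule: finite_induct)
  case empty
  obtain G where "G \<in> S" using assms(2) by auto
  then have "(\<lambda>x. 0 *\<^sub>R G x) \<in> lin_closure K S"
    by (intro lin_closure.scale lin_closure.base)
  then show ?case by simp
next
  case (insert i I)
  have "(\<lambda>x. F i x + (\<Sum>i\<in>I. F i x)) \<in> lin_closure K S"
    by (rule lin_closure.add) (use insert in auto)
  then show ?case using insert.hyps by simp
qed

text \<open>Boundedness survives a limit because one approximant within distance 1 already bounds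
  \<open>F\<close>. It is needed because multiplication by a fixed function preserves uniform limits
  only if that function is bounded on \<open>K\<close>.\<close>

lemma lin_closure_bounded:
  assumes "F \<in> lin_closure K S" and "\<And>F. F \<in> S \<Longrightarrow> bounded (F ` K)"
  shows "bounded (F ` K)"
  using assms(1)
proof induction
  case (base F) then show ?case by (rule assms(2))
next
  case (scale F c)
  then show ?case using bounded_scaling[of "F ` K" c] by (simp add: image_image)
next
  case (add F G) then show ?case by (intro bounded_plus_comp)
next
  case (lim F)
  then obtain G where G: "bounded (G ` K)" "\<And>x. x \<in> K \<Longrightarrow> norm (F x - G x) < 1"
    by (meson zero_less_one)
  then obtain B where "\<And>x. x \<in> K \<Longrightarrow> norm (G x) \<le> B" by (auto simp: bounded_iff)
  with G(2) have "norm (F x) \<le> B + 1" if "x \<in> K" for x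
    using norm_triangle_sub[of "F x" "G x"] that by fastforce
  then show ?case by (auto simp: bounded_iff)
qed

text \<open>Two inductions, one per factor: first \<open>F\<close> runs through the closure while
  \<open>G\<close> is a generator, then \<open>G\<close> runs through the closure with
  \<open>F\<close> arbitrary. Bilinearity settles scaling and sums, boundedness settles
  limits.\<close>

lemma lin_closure_bilinear:
  fixes m :: "'b \<Rightarrow> 'b \<Rightarrow> 'b::real_normed_vector" and K :: "'a set"
  assumes bb: "bounded_bilinear m"
    and bd: "\<And>F. F \<in> S \<Longrightarrow> bounded (F ` K)"
    and mS: "\<And>F G. F \<in> S \<Longrightarrow> G \<in> S \<Longrightarrow> (\<lambda>x. m (F x) (G x)) \<in> lin_closure K S"
    and F: "F \<in> lin_closure K S" and G: "G \<in> lin_closure K S"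
  shows "(\<lambda>x. m (F x) (G x)) \<in> lin_closure K S"
proof -
  interpret bounded_bilinear m by fact
  obtain C where C: "C > 0" "\<And>a b. norm (m a b) \<le> norm a * norm b * C"
    using pos_bounded by blast
  \<comment> \<open>Multiplication by \<open>G x\<close>, from either side, is continuous at 0
    uniformly in \<open>x\<close>: with \<open>B\<close> bounding \<open>G\<close> on
    \<open>K\<close> and \<open>C\<close> the bilinear constant, \<open>e / (B * C)\<close>
    works.\<close>
  have limit: "\<exists>d>0. \<forall>x\<in>K. \<forall>a. norm a < d \<longrightarrow> norm (m a (G x)) < e \<and> norm (m (G x) a) < e"
    if G: "G \<in> lin_closure K S" and e: "e > 0" for e G
  proof -
    obtain B where B: "B > 0" "\<And>x. x \<in> K \<Longrightarrow> norm (G x) \<le> B"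
      using lin_closure_bounded[OF G] bd by (auto simp: bounded_pos)
    show ?thesis
    proof (intro exI[of _ "e / (B * C)"] conjI ballI allI impI)
      show "e / (B * C) > 0" using B C e by simp
      fix x and a :: 'b assume x: "x \<in> K" and a: "norm a < e / (B * C)"
      have "norm a * (norm (G x) * C) \<le> norm a * (B * C)"
        by (intro mult_left_mono mult_right_mono) (use B(2)[OF x] C in auto)
      also have "\<dots> < e" using a B C by (simp add: field_simps)
      finally have "norm a * (norm (G x) * C) < e" .
      then show "norm (m a (G x)) < e" "norm (m (G x) a) < e"
        using C(2)[of a "G x"] C(2)[of "G x" a] by (auto simp: mult_ac)
    qed
  qed
  have 1: "(\<lambda>x. m (F x) (G x)) \<in> lin_closure K S" if G: "G \<in> S" for G
    using F
  proof induction
    case (base F) then show ?case using mS G by blast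
  next
    case (scale F c) then show ?case by (simp add: scaleR_left lin_closure.scale)
  next
    case (add F F') then show ?case by (simp add: add_left lin_closure.add)
  next
    case (lim F)
    show ?case
    proof (rule lin_closure.lim)
      fix e :: real assume "e > 0"
      then obtain d where d: "d > 0" "\<And>x a. x \<in> K \<Longrightarrow> norm a < d \<Longrightarrow> norm (m a (G x)) < e"
        using limit[OF lin_closure.base[OF G]] by blast
      obtain H where "(\<lambda>x. m (H x) (G x)) \<in> lin_closure K S" "\<forall>x\<in>K. norm (F x - H x) < d"
        using lim[OF d(1)] by blast
      then show "\<exists>H. H \<in> lin_closure K S \<and> (\<forall>x\<in>K. norm (m (F x) (G x) - H x) < e)"
        using d(2) by (intro exI[of _ "\<lambda>x. m (H x) (G x)"]) (simp flip: diff_left)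
    qed
  qed
  show ?thesis
    using G
  proof induction
    case (base G) then show ?case by (rule 1)
  next
    case (scale G c) then show ?case by (simp add: scaleR_right lin_closure.scale)
  next
    case (add G G') then show ?case by (simp add: add_right lin_closure.add)
  next
    case (lim G)
    show ?case
    proof (rule lin_closure.lim)
      fix e :: real assume "e > 0"
      then obtain d where d: "d > 0" "\<And>x a. x \<in> K \<Longrightarrow> norm a < d \<Longrightarrow> norm (m (F x) a) < e"
        using limit[OF F] by blast
      obtain H where "(\<lambda>x. m (F x) (H x)) \<in> lin_closure K S" "\<forall>x\<in>K. norm (G x - H x) < d"
        using lim[OF d(1)] by blast
      then show "\<exists>H. H \<in> lin_closure K S \<and> (\<forall>x\<in>K. norm (m (F x) (G x) - H x) < e)"
        using d(2) by (intro exI[of _ "\<lambda>x. m (F x) (H x)"]) (simp flip: diff_right)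
    qed
  qed
qed

lemma norm_fst_snd_le: "norm (fst c) \<le> norm c" "norm (snd c) \<le> norm c"
  using norm_fst_le[of "fst c" "snd c"] norm_snd_le[of "snd c" "fst c"] by simp_all

subsection \<open>Jets of exponentials and of \<open>tanh\<close>\<close>

text \<open>The Leibniz rule: this is the jet of the product of two functions with jets
  \<open>F\<close> and \<open>G\<close>.\<close>

definition jet_mult :: "real \<times> 'a \<Rightarrow> real \<times> 'a \<Rightarrow> real \<times> 'a::real_vector" where
  "jet_mult F G = (fst F * fst G, fst F *\<^sub>R snd G + fst G *\<^sub>R snd F)"

lemma bounded_bilinear_jet_mult:
  "bounded_bilinear (jet_mult :: real \<times> 'a::real_normed_vector \<Rightarrow> _)"
proof
  show "\<exists>K. \<forall>a b::real \<times> 'a. norm (jet_mult a b) \<le> norm a * norm b * K"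
  proof (intro exI allI)
    fix a b :: "real \<times> 'a"
    have "norm (jet_mult a b) \<le> norm (fst a * fst b) + norm (fst a *\<^sub>R snd b + fst b *\<^sub>R snd a)"
      unfolding jet_mult_def by (rule norm_Pair_le)
    also have "\<dots> \<le> norm (fst a) * norm (fst b) + (norm (fst a) * norm (snd b) + norm (fst b) * norm (snd a))"
      by (intro add_mono order_trans[OF norm_triangle_ineq]) (auto simp: abs_mult)
    also have "\<dots> \<le> norm a * norm b + (norm a * norm b + norm b * norm a)"
      by (intro add_mono mult_mono norm_fst_snd_le norm_ge_zero mult_nonneg_nonneg)
    finally show "norm (jet_mult a b) \<le> norm a * norm b * 3" by simp
  qed
qed (auto simp: jet_mult_def algebra_simps)

definition tanh_jet :: "'a::real_inner \<Rightarrow> real \<Rightarrow> 'a \<Rightarrow> real \<times> 'a" where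
  "tanh_jet a b x = (tanh (a \<bullet> x + b), (1 - (tanh (a \<bullet> x + b))\<^sup>2) *\<^sub>R a)"

definition exp_jet :: "'a::real_inner \<Rightarrow> 'a \<Rightarrow> real \<times> 'a" where
  "exp_jet a x = (exp (a \<bullet> x), exp (a \<bullet> x) *\<^sub>R a)"

text \<open>Up to scaling by \<open>exp B\<close>, the left tail of \<open>1 + tanh ((s - B) / 2)\<close> is \<open>exp s\<close>.\<close>

lemma exp_jet_in_tanh_closure:
  fixes K :: "'a::real_inner set"
  assumes "bounded K"
  shows "exp_jet a \<in> lin_closure K (range (\<lambda>(a, b). tanh_jet a b))"
proof (rule lin_closure.lim)
  fix e :: real assume e: "e > 0"
  let ?L = "lin_closure K (range (\<lambda>(a, b). tanh_jet a b))"
  obtain R where R: "\<And>x. x \<in> K \<Longrightarrow> norm x \<le> R" using assms by (auto simp: bounded_iff)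
  define M where "M = exp (norm a * R)"
  have M: "0 < M" "exp (a \<bullet> x) \<le> M" if "x \<in> K" for x
  proof -
    have "a \<bullet> x \<le> norm a * R"
      by (rule order_trans[OF norm_cauchy_schwarz]) (use R that in \<open>simp add: mult_left_mono\<close>)
    then show "0 < M" "exp (a \<bullet> x) \<le> M" by (auto simp: M_def)
  qed
  have "M > 0" by (simp add: M_def)
  \<comment> \<open>Chosen so that the final error bound
    \<open>M\<^sup>2 * (\<delta> * (1 + 2 * norm a))\<close> equals \<open>e / 2\<close>. The shift
    \<open>B\<close> of the tail is \<open>- ln \<delta>\<close>.\<close>
  define \<delta> where "\<delta> = e / (2 * M\<^sup>2 * (1 + 2 * norm a))"
  have den: "2 * M\<^sup>2 * (1 + 2 * norm a) > 0"
    using \<open>M > 0\<close> by (simp add: add_pos_nonneg)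
  have \<delta>: "\<delta> > 0" using e den by (simp add: \<delta>_def)
  define T where "T = tanh_jet (a /\<^sub>R 2) (ln \<delta> / 2)"
  \<comment> \<open>Networks have no output bias, so the constant 1 is produced by a unit with zero
    weight: \<open>tanh_jet 0 1\<close> is the constant jet \<open>(tanh 1, 0)\<close>.\<close>
  define G where "G = (\<lambda>x. (1 / (2 * \<delta>)) *\<^sub>R (T x + (1 / tanh 1) *\<^sub>R tanh_jet 0 1 x))"
  have in_L: "tanh_jet c d \<in> ?L" for c d
    by (rule lin_closure.base) (auto intro: image_eqI[of _ _ "(c, d)"])
  have "G \<in> ?L"
    unfolding G_def T_def by (intro lin_closure.scale lin_closure.add in_L)
  moreover have "norm (exp_jet a x - G x) < e" if x: "x \<in> K" for x
  proof -
    define s where "s = exp (a \<bullet> x)"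
    define z where "z = \<delta> * s"
    have s: "s > 0" "s \<le> M" using M[OF x] by (auto simp: s_def)
    have z: "z > 0" using \<delta> s by (simp add: z_def)
    \<comment> \<open>The argument is half of \<open>ln z\<close>, and \<open>tanh\<close> turns it
      into a rational function of \<open>z\<close>. Hence \<open>G\<close> has value
      \<open>s / (1 + z)\<close> and gradient factor \<open>s / (1 + z)\<^sup>2\<close>, both close
      to \<open>s\<close> when \<open>z\<close> is small.\<close>
    have th: "tanh ((a /\<^sub>R 2) \<bullet> x + ln \<delta> / 2) = (z - 1) / (z + 1)"
    proof -
      have "- 2 * ((a /\<^sub>R 2) \<bullet> x + ln \<delta> / 2) = - (ln \<delta> + a \<bullet> x)" by simp
      moreover have "exp (- (ln \<delta> + a \<bullet> x)) = 1 / z"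
        using \<delta> by (simp only: exp_minus exp_add exp_ln z_def s_def divide_inverse mult_1)
      ultimately have "tanh ((a /\<^sub>R 2) \<bullet> x + ln \<delta> / 2) = (1 - 1 / z) / (1 + 1 / z)"
        by (simp only: tanh_real_altdef)
      also have "\<dots> = (z - 1) / (z + 1)" using z by (simp add: divide_simps)
      finally show ?thesis .
    qed
    then have th': "tanh (a \<bullet> x / 2 + ln \<delta> / 2) = (z - 1) / (z + 1)" by simp
    have zs: "z / \<delta> = s" using \<delta> by (simp add: z_def)
    have G1: "fst (G x) = s / (1 + z)"
    proof -
      have "tanh (1::real) \<noteq> 0" by simp
      then have "fst (G x) = (1 / (2 * \<delta>)) * ((z - 1) / (z + 1) + 1)"
        by (simp add: G_def T_def tanh_jet_def th')
      also have "(z - 1) / (z + 1) + 1 = 2 * z / (1 + z)"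
        using z by (simp add: divide_simps)
      finally show ?thesis by (simp flip: zs)
    qed
    have "1 - ((z - 1) / (z + 1))\<^sup>2 = 4 * z / (1 + z)\<^sup>2"
    proof -
      have "1 - ((z - 1) / (z + 1))\<^sup>2 = ((z + 1)\<^sup>2 - (z - 1)\<^sup>2) / (z + 1)\<^sup>2"
        using z by (simp only: power_divide) (simp only: diff_divide_distrib, simp)
      also have "(z + 1)\<^sup>2 - (z - 1)\<^sup>2 = 4 * z" by (simp add: power2_eq_square algebra_simps)
      finally show ?thesis by (simp add: add.commute)
    qed
    then have G2: "snd (G x) = (s / (1 + z)\<^sup>2) *\<^sub>R a"
      by (simp add: G_def T_def tanh_jet_def th' flip: zs)
    have "s - s / (1 + z) = s * z / (1 + z)" using z by (simp add: field_simps)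
    also have "\<dots> \<le> s * z" using s z by (simp add: divide_le_eq)
    finally have a1: "\<bar>s - s / (1 + z)\<bar> \<le> s * z" using s z by (simp add: field_simps)
    have "s - s / (1 + z)\<^sup>2 = s * ((2 * z + z\<^sup>2) / (1 + z)\<^sup>2)"
    proof -
      define D where "D = (1 + z)\<^sup>2"
      have "D > 0" using z by (simp add: D_def)
      then have "s - s / D = s * ((D - 1) / D)" by (simp add: field_simps)
      moreover have "2 * z + z\<^sup>2 = D - 1" by (simp add: D_def power2_eq_square algebra_simps)
      ultimately show ?thesis unfolding D_def[symmetric] by (simp only:)
    qed
    moreover have "(2 * z + z\<^sup>2) / (1 + z)\<^sup>2 \<le> 2 * z"
    proof -
      have "2 * z + z\<^sup>2 \<le> 2 * z * (1 + z)\<^sup>2"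
        using z by (simp add: power2_eq_square algebra_simps)
      then show ?thesis using z by (simp add: divide_le_eq)
    qed
    moreover have "0 \<le> (2 * z + z\<^sup>2) / (1 + z)\<^sup>2" using z by simp
    ultimately have a2: "\<bar>s - s / (1 + z)\<^sup>2\<bar> \<le> s * (2 * z)"
      using s(1) by (simp only: abs_mult abs_of_nonneg less_imp_le mult_left_mono)
    have "norm (exp_jet a x - G x) \<le> \<bar>s - s / (1 + z)\<bar> + norm ((s - s / (1 + z)\<^sup>2) *\<^sub>R a)"
    proof -
      have "exp_jet a x - G x = (s - s / (1 + z), (s - s / (1 + z)\<^sup>2) *\<^sub>R a)"
        by (simp add: exp_jet_def prod_eq_iff G1 G2 s_def scaleR_diff_left)
      then show ?thesis by (simp only: norm_Pair_le flip: real_norm_def)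
    qed
    also have "\<dots> \<le> s * z + s * (2 * z) * norm a"
      unfolding norm_scaleR by (intro add_mono mult_right_mono a1 a2 norm_ge_zero)
    also have "\<dots> = s\<^sup>2 * (\<delta> * (1 + 2 * norm a))"
      by (simp add: z_def power2_eq_square algebra_simps)
    also have "\<dots> \<le> M\<^sup>2 * (\<delta> * (1 + 2 * norm a))"
      using s \<delta> by (intro mult_right_mono power_mono) auto
    also have "\<dots> = e / 2"
      using den unfolding \<delta>_def by (simp add: field_simps)
    finally show ?thesis using e by simp
  qed
  ultimately show "\<exists>G. G \<in> ?L \<and> (\<forall>x\<in>K. norm (exp_jet a x - G x) < e)" by blast
qed

lemma exp_jet_bounded:
  fixes K :: "'a::euclidean_space set"
  assumes "compact K"
  shows "bounded (exp_jet a ` K)"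
  unfolding exp_jet_def
  by (intro compact_imp_bounded compact_continuous_image continuous_intros assms)

lemma exp_closure_mult:
  fixes K :: "'a::euclidean_space set"
  assumes "compact K" "F \<in> lin_closure K (range exp_jet)" "G \<in> lin_closure K (range exp_jet)"
  shows "(\<lambda>x. jet_mult (F x) (G x)) \<in> lin_closure K (range exp_jet)"
proof (rule lin_closure_bilinear[OF bounded_bilinear_jet_mult _ _ assms(2,3)])
  fix F G :: "'a \<Rightarrow> real \<times> 'a" assume "F \<in> range exp_jet" "G \<in> range exp_jet"
  then obtain a b where "F = exp_jet a" "G = exp_jet b" by auto
  then have "(\<lambda>x. jet_mult (F x) (G x)) = exp_jet (a + b)"
    by (auto simp: exp_jet_def jet_mult_def fun_eq_iff inner_add_left exp_add algebra_simps)
  then show "(\<lambda>x. jet_mult (F x) (G x)) \<in> lin_closure K (range exp_jet)"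
    by (auto intro: lin_closure.base)
qed (use exp_jet_bounded[OF assms(1)] in auto)

lemma const_jet_in_exp_closure: "(\<lambda>x. (c, 0)) \<in> lin_closure K (range exp_jet)"
proof -
  have "(\<lambda>x. c *\<^sub>R exp_jet 0 x) \<in> lin_closure K (range exp_jet)"
    by (intro lin_closure.scale lin_closure.base) auto
  then show ?thesis by (simp add: exp_jet_def)
qed

lemma linear_jet_in_exp_closure:
  fixes a :: "'a::real_inner"
  assumes "bounded K"
  shows "(\<lambda>x. (a \<bullet> x, a)) \<in> lin_closure K (range exp_jet)"
proof (rule lin_closure.lim)
  fix e :: real assume e: "e > 0"
  obtain R where R: "\<And>x. x \<in> K \<Longrightarrow> norm x \<le> R" using assms by (auto simp: bounded_iff)
  define M where "M = norm a * R"
  have M: "\<bar>a \<bullet> x\<bar> \<le> M" if "x \<in> K" for x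
    unfolding M_def
    by (rule order_trans[OF Cauchy_Schwarz_ineq2]) (use R that in \<open>simp add: mult_left_mono\<close>)
  \<comment> \<open>With \<open>q = exp (s * \<bar>M\<bar>) - 1\<close>, the value error of the
    difference quotient is at most \<open>\<bar>M\<bar> * q\<close> and its gradient error at most
    \<open>q * norm a\<close>; the displayed quantity is their sum. The absolute value covers an
    empty \<open>K\<close>, for which \<open>R\<close> may be negative.\<close>
  have "((\<lambda>s. (exp (s * \<bar>M\<bar>) - 1) * (\<bar>M\<bar> + norm a)) \<longlongrightarrow> (exp (0 * \<bar>M\<bar>) - 1) * (\<bar>M\<bar> + norm a)) (at_right 0)"
    by (intro tendsto_intros)
  then have "\<forall>\<^sub>F s in at_right 0. (exp (s * \<bar>M\<bar>) - 1) * (\<bar>M\<bar> + norm a) < e"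
    using e by (intro order_tendstoD(2)) auto
  with eventually_at_right_less
  have "\<forall>\<^sub>F s in at_right 0. 0 < s \<and> (exp (s * \<bar>M\<bar>) - 1) * (\<bar>M\<bar> + norm a) < e"
    by (rule eventually_conj)
  then obtain s :: real where s: "s > 0" "(exp (s * \<bar>M\<bar>) - 1) * (\<bar>M\<bar> + norm a) < e"
    using eventually_happens[of _ "at_right (0::real)"] by auto
  define G where "G = (\<lambda>x. (1 / s) *\<^sub>R (exp_jet (s *\<^sub>R a) x - exp_jet 0 x))"
  have "G \<in> lin_closure K (range exp_jet)"
    unfolding G_def by (intro lin_closure.scale lin_closure_diff lin_closure.base) auto
  moreover have "norm ((a \<bullet> x, a) - G x) < e" if x: "x \<in> K" for x
  proof -
    define r where "r = a \<bullet> x"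
    define q where "q = exp (s * \<bar>M\<bar>) - 1"
    have r: "\<bar>r\<bar> \<le> \<bar>M\<bar>" using M[OF x] by (auto simp: r_def)
    have lo: "1 + s * r \<le> exp (s * r)" by simp
    have sr: "\<bar>s * r\<bar> \<le> s * \<bar>M\<bar>" using r s by (simp add: abs_mult)
    have q: "\<bar>exp (s * r) - 1\<bar> \<le> q"
    proof -
      have "exp (s * r) \<le> exp (s * \<bar>M\<bar>)" using sr by simp
      moreover have "1 - exp (s * r) \<le> s * \<bar>M\<bar>" using lo sr by linarith
      moreover have "1 + s * \<bar>M\<bar> \<le> exp (s * \<bar>M\<bar>)" by simp
      ultimately show ?thesis unfolding q_def by linarith
    qed
    \<comment> \<open>Multiplying \<open>1 - s * r \<le> exp (- (s * r))\<close> by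
      \<open>exp (s * r)\<close> bounds the second-order remainder of \<open>exp\<close> by a
      product of two first-order quantities, without Taylor's theorem.\<close>
    have "(1 - s * r) * exp (s * r) \<le> exp (- (s * r)) * exp (s * r)"
      using exp_ge_add_one_self[of "- (s * r)"] by (intro mult_right_mono) auto
    then have "exp (s * r) - 1 - s * r \<le> s * r * (exp (s * r) - 1)"
      by (simp add: algebra_simps flip: exp_add)
    also have "\<dots> \<le> s * (\<bar>M\<bar> * q)"
    proof -
      have "r * (exp (s * r) - 1) \<le> \<bar>r\<bar> * \<bar>exp (s * r) - 1\<bar>" by (metis abs_ge_self abs_mult)
      also have "\<dots> \<le> \<bar>M\<bar> * q" using r q by (intro mult_mono) auto
      finally show ?thesis using s by (simp add: mult.assoc)
    qed
    finally have up: "exp (s * r) - 1 - s * r \<le> s * (\<bar>M\<bar> * q)" .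
    have "\<bar>r - (exp (s * r) - 1) / s\<bar> = \<bar>(exp (s * r) - 1 - s * r) / s\<bar>"
      using s by (simp add: diff_divide_distrib abs_minus_commute)
    also have "\<dots> = (exp (s * r) - 1 - s * r) / s"
      by (intro abs_of_nonneg divide_nonneg_pos s(1)) (use lo in linarith)
    also have "\<dots> \<le> \<bar>M\<bar> * q"
      unfolding pos_divide_le_eq[OF s(1)] using up by (simp only: mult.commute)
    finally have e1: "\<bar>r - (exp (s * r) - 1) / s\<bar> \<le> \<bar>M\<bar> * q" .
    have e2: "norm ((1 - exp (s * r)) *\<^sub>R a) \<le> q * norm a"
      using mult_right_mono[OF q norm_ge_zero[of a]] by (simp add: abs_minus_commute)
    have "(a \<bullet> x, a) - G x = (r - (exp (s * r) - 1) / s, (1 - exp (s * r)) *\<^sub>R a)"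
      using s by (simp add: G_def exp_jet_def r_def scaleR_diff_left)
    then have "norm ((a \<bullet> x, a) - G x) \<le> \<bar>M\<bar> * q + q * norm a"
      using order_trans[OF norm_Pair_le add_mono[OF e1[folded real_norm_def] e2]] by simp
    also have "\<dots> < e" using s(2) by (simp only: q_def distrib_right mult.commute)
    finally show ?thesis .
  qed
  ultimately show "\<exists>G. G \<in> lin_closure K (range exp_jet) \<and> (\<forall>x\<in>K. norm ((a \<bullet> x, a) - G x) < e)"
    by (intro exI[of _ G]) simp
qed

definition poly_jet :: "real poly \<Rightarrow> 'a::real_inner \<Rightarrow> 'a \<Rightarrow> real \<times> 'a" where
  "poly_jet q j x = (poly q (x \<bullet> j), poly (pderiv q) (x \<bullet> j) *\<^sub>R j)"

text \<open>Horner's scheme: each step multiplies by the coordinate jet and adds a constant, and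
  \<open>jet_mult\<close> produces the rule for \<open>pderiv\<close> of \<open>pCons\<close> on its
  own.\<close>

lemma poly_jet_in_exp_closure:
  fixes j :: "'a::euclidean_space"
  assumes "compact K"
  shows "poly_jet q j \<in> lin_closure K (range exp_jet)"
proof (induction q)
  case 0
  then show ?case using const_jet_in_exp_closure[of 0 K] by (simp add: poly_jet_def)
next
  case (pCons c q)
  have "(\<lambda>x. (c, 0) + jet_mult (j \<bullet> x, j) (poly_jet q j x)) \<in> lin_closure K (range exp_jet)"
    by (intro lin_closure.add const_jet_in_exp_closure exp_closure_mult assms pCons.IH
        linear_jet_in_exp_closure compact_imp_bounded)
  also have "(\<lambda>x. (c, 0) + jet_mult (j \<bullet> x, j) (poly_jet q j x)) = poly_jet (pCons c q) j"
    by (auto simp: poly_jet_def jet_mult_def fun_eq_iff pderiv_pCons inner_commute algebra_simps)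
  finally show ?case .
qed

subsection \<open>Bernstein approximation with derivatives\<close>

text \<open>The variance of \<open>k / n\<close> under the binomial distribution with success
  probability \<open>t\<close>, obtained from the known first and second factorial moments.\<close>

lemma Bernstein_variance:
  assumes "n > 0"
  shows "(\<Sum>k\<le>n. Bernstein n k t * (real k / real n - t)\<^sup>2) = t * (1 - t) / real n"
proof -
  have "(\<Sum>k\<le>n. Bernstein n k t * (real k / real n - t)\<^sup>2)
      = (\<Sum>k\<le>n. (real k * (real k - 1) * Bernstein n k t) / (real n)\<^sup>2
          + (real k * Bernstein n k t) * (1 / (real n)\<^sup>2 - 2 * t / real n) + t\<^sup>2 * Bernstein n k t)"
    using assms by (intro sum.cong refl) (simp add: field_simps power2_eq_square)
  also have "\<dots> = real n * (real n - 1) * t\<^sup>2 / (real n)\<^sup>2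
      + real n * t * (1 / (real n)\<^sup>2 - 2 * t / real n) + t\<^sup>2"
    by (simp only: sum.distrib sum_Bernstein sum_k_Bernstein sum_kk_Bernstein mult_1_right
        flip: sum_divide_distrib sum_distrib_right sum_distrib_left)
  also have "\<dots> = t * (1 - t) / real n"
    using assms by (simp add: field_simps power2_eq_square)
  finally show ?thesis .
qed

text \<open>A quadratic modulus of continuity turns the variance of the Bernstein weights into an
  error bound.\<close>

lemma Bernstein_average:
  fixes c :: "nat \<Rightarrow> 'b::real_normed_vector"
  assumes n: "n > 0" and t: "0 \<le> t" "t \<le> 1" and M: "M \<ge> 0"
    and c: "\<And>k. k \<le> n \<Longrightarrow> norm (c k - c0) \<le> e + M * (real k / real n - t)\<^sup>2"
  shows "norm ((\<Sum>k\<le>n. Bernstein n k t *\<^sub>R c k) - c0) \<le> e + M / real n"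
proof -
  have "(\<Sum>k\<le>n. Bernstein n k t *\<^sub>R c k) - c0 = (\<Sum>k\<le>n. Bernstein n k t *\<^sub>R (c k - c0))"
    by (simp add: scaleR_diff_right sum_subtractf flip: scaleR_sum_left)
  also have "norm \<dots> \<le> (\<Sum>k\<le>n. Bernstein n k t * (e + M * (real k / real n - t)\<^sup>2))"
    by (rule order_trans[OF norm_sum sum_mono])
      (use c t in \<open>auto simp: Bernstein_nonneg intro!: mult_left_mono\<close>)
  also have "\<dots> = (\<Sum>k\<le>n. Bernstein n k t) * e + M * (\<Sum>k\<le>n. Bernstein n k t * (real k / real n - t)\<^sup>2)"
    by (simp only: distrib_left sum.distrib sum_distrib_left sum_distrib_right mult_ac)
  also have "\<dots> = e + M * (t * (1 - t)) / real n"
    using n by (simp only: Bernstein_variance sum_Bernstein mult_1 times_divide_eq_right)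
  also have "\<dots> \<le> e + M * 1 / real n"
    using t M by (intro add_left_mono divide_right_mono mult_left_mono mult_le_one) auto
  finally show ?thesis by simp
qed

text \<open>\<open>Bernstein\<close> as an element of the polynomial type, so that
  \<open>pderiv\<close> and \<open>poly_jet\<close> apply to it.\<close>

definition Bernstein_poly :: "nat \<Rightarrow> nat \<Rightarrow> real poly" where
  "Bernstein_poly n k = smult (of_nat (n choose k)) ([:0, 1:] ^ k * [:1, -1:] ^ (n - k))"

lemma poly_Bernstein_poly: "poly (Bernstein_poly n k) t = Bernstein n k t"
  by (simp add: Bernstein_poly_def Bernstein_def)

lemma pderiv_Bernstein_poly_0:
  "poly (pderiv (Bernstein_poly (Suc n) 0)) t = - real (Suc n) * Bernstein n 0 t"
  by (simp add: Bernstein_poly_def Bernstein_def pderiv_power_Suc pderiv_smult pderiv_pCons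
      del: power_Suc of_nat_Suc)

text \<open>The factors \<open>Suc k\<close> and \<open>Suc m\<close> from the power rule are
  absorbed into the binomial coefficient, which lowers the degree by one. The top index
  \<open>k = n\<close> is separate because there the power of \<open>1 - t\<close> has exponent
  0.\<close>

lemma pderiv_Bernstein_poly_Suc:
  assumes "k \<le> n"
  shows "poly (pderiv (Bernstein_poly (Suc n) (Suc k))) t
    = real (Suc n) * (Bernstein n k t - Bernstein n (Suc k) t)"
proof -
  have a: "real (Suc n choose Suc k) * real (Suc k) = real (Suc n) * real (n choose k)"
    by (metis Suc_times_binomial mult.commute of_nat_mult)
  show ?thesis
  proof (cases "k = n")
    case True
    then show ?thesis
      by (simp add: Bernstein_poly_def Bernstein_def pderiv_power_Suc pderiv_smult pderiv_pCons
      del: power_Suc)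
  next
    case False
    then obtain m where m: "n = Suc (k + m)"
      using assms by (metis less_iff_Suc_add le_neq_implies_less)
    have "(Suc n choose Suc k) * Suc m = Suc n * (n choose Suc k)"
      using binomial_absorb_comp[of "Suc n" "Suc k"] unfolding m
      by (simp del: binomial_Suc_Suc add: mult.commute)
    then have b: "real (Suc n choose Suc k) * real (Suc m) = real (Suc n) * real (n choose Suc k)"
      by (metis of_nat_mult)
    have "poly (pderiv (Bernstein_poly (Suc n) (Suc k))) t
      = (real (Suc n choose Suc k) * real (Suc k)) * (t ^ k * (1 - t) ^ Suc m)
        - (real (Suc n choose Suc k) * real (Suc m)) * (t ^ Suc k * (1 - t) ^ m)"
      by (simp add: m Bernstein_poly_def pderiv_mult pderiv_power_Suc pderiv_smult pderiv_pCons
        algebra_simps del: power_Suc binomial_Suc_Suc of_nat_Suc)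
    also have "\<dots> = real (Suc n) * (Bernstein n k t - Bernstein n (Suc k) t)"
      unfolding a b by (simp add: Bernstein_def m algebra_simps del: binomial_Suc_Suc of_nat_Suc)
    finally show ?thesis .
  qed
qed

text \<open>Summation by parts. With \<open>c k\<close> the value at the node
  \<open>k / Suc n\<close>, the right-hand side is a Bernstein average, of degree \<open>n\<close>,
  of forward difference quotients with step \<open>1 / Suc n\<close>. This is why derivatives
  converge together with values.\<close>

lemma sum_pderiv_Bernstein_poly:
  fixes c :: "nat \<Rightarrow> real"
  shows "(\<Sum>k\<le>Suc n. c k * poly (pderiv (Bernstein_poly (Suc n) k)) t)
    = (\<Sum>k\<le>n. Bernstein n k t * (real (Suc n) * (c (Suc k) - c k)))"
proof -
  have "(\<Sum>k\<le>Suc n. c k * poly (pderiv (Bernstein_poly (Suc n) k)) t)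
    = real (Suc n) * ((\<Sum>k\<le>n. c (Suc k) * Bernstein n k t)
        - (c 0 * Bernstein n 0 t + (\<Sum>k\<le>n. c (Suc k) * Bernstein n (Suc k) t)))"
    by (simp add: sum.atMost_Suc_shift pderiv_Bernstein_poly_0 pderiv_Bernstein_poly_Suc
       sum_distrib_left sum_subtractf algebra_simps del: sum.atMost_Suc of_nat_Suc)
  also have "c 0 * Bernstein n 0 t + (\<Sum>k\<le>n. c (Suc k) * Bernstein n (Suc k) t)
    = (\<Sum>k\<le>Suc n. c k * Bernstein n k t)"
    by (simp add: sum.atMost_Suc_shift del: sum.atMost_Suc)
  \<comment> \<open>The term with index \<open>Suc n\<close> vanishes because
    \<open>n choose Suc n\<close> is 0.\<close>
  also have "\<dots> = (\<Sum>k\<le>n. c k * Bernstein n k t)"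
    by (simp add: Bernstein_def)
  finally show ?thesis
    by (simp add: sum_distrib_left sum_subtractf algebra_simps)
qed

section \<open>C1 jets and the Bernstein operator in one coordinate\<close>

definition C1_jet :: "('a::euclidean_space \<Rightarrow> real \<times> 'a) \<Rightarrow> bool" where
  "C1_jet F \<longleftrightarrow> (\<forall>x. ((\<lambda>y. fst (F y)) has_derivative (\<lambda>h. snd (F x) \<bullet> h)) (at x))
    \<and> continuous_on UNIV (\<lambda>x. snd (F x))"

lemma C1_jet_continuous: "C1_jet F \<Longrightarrow> continuous_on UNIV F"
proof -
  assume "C1_jet F"
  then have "continuous_on UNIV (\<lambda>x. (fst (F x), snd (F x)))"
    unfolding C1_jet_def by (intro continuous_on_Pair) (auto intro: has_derivative_continuous_on)
  then show ?thesis by simp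
qed

definition set_coord :: "'a::euclidean_space \<Rightarrow> real \<Rightarrow> 'a \<Rightarrow> 'a" where
  "set_coord j s x = x + (s - x \<bullet> j) *\<^sub>R j"

text \<open>The jet of the function with coordinate \<open>j\<close> frozen at \<open>s\<close>. By
  the chain rule its gradient is projected orthogonally to \<open>j\<close>, which is what makes the
  induction over coordinates advance.\<close>

definition slice_jet :: "('a::euclidean_space \<Rightarrow> real \<times> 'a) \<Rightarrow> 'a \<Rightarrow> real \<Rightarrow> 'a \<Rightarrow> real \<times> 'a" where
  "slice_jet F j s x =
    (fst (F (set_coord j s x)), snd (F (set_coord j s x)) - (snd (F (set_coord j s x)) \<bullet> j) *\<^sub>R j)"

lemma C1_jet_slice:
  assumes "C1_jet F"
  shows "C1_jet (slice_jet F j s)"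
  unfolding C1_jet_def
proof (intro conjI allI)
  have F: "((\<lambda>y. fst (F y)) has_derivative (\<lambda>h. snd (F x) \<bullet> h)) (at x)" for x
    using assms by (simp add: C1_jet_def)
  fix x
  have "(set_coord j s has_derivative (\<lambda>h. h - (h \<bullet> j) *\<^sub>R j)) (at x)"
    unfolding set_coord_def by (auto intro!: derivative_eq_intros)
  from has_derivative_compose[OF this F]
  have "((\<lambda>y. fst (F (set_coord j s y))) has_derivative
      (\<lambda>h. snd (F (set_coord j s x)) \<bullet> (h - (h \<bullet> j) *\<^sub>R j))) (at x)" .
  then show "((\<lambda>y. fst (slice_jet F j s y)) has_derivative (\<lambda>h. snd (slice_jet F j s x) \<bullet> h)) (at x)"
    by (simp add: slice_jet_def inner_diff_left inner_diff_right inner_commute mult.commute)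
next
  have c: "continuous_on UNIV (\<lambda>x. snd (F (set_coord j s x)))"
  proof (rule continuous_on_compose2[of UNIV "\<lambda>x. snd (F x)"])
    show "continuous_on UNIV (set_coord j s)" unfolding set_coord_def by (intro continuous_intros)
  qed (use assms in \<open>auto simp: C1_jet_def\<close>)
  show "continuous_on UNIV (\<lambda>x. snd (slice_jet F j s x))"
    unfolding slice_jet_def snd_conv by (intro continuous_intros c)
qed

lemma set_coord_in_cube:
  assumes "x \<in> cbox 0 One" "0 \<le> s" "s \<le> 1" "j \<in> Basis"
  shows "set_coord j s x \<in> cbox 0 One"
  using assms by (auto simp: mem_box set_coord_def inner_add_left inner_Basis)

text \<open>For displacements below the \<open>d\<close> of uniform continuity the error is below
  \<open>e\<close>; for larger ones the trivial bound \<open>2 * B\<close> is at most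
  \<open>2 * B\<close> times the squared displacement over \<open>d\<^sup>2\<close>. The quadratic
  form is what \<open>Bernstein_average\<close> consumes.\<close>

lemma quadratic_modulus:
  fixes F :: "'a::euclidean_space \<Rightarrow> 'b::real_normed_vector"
  assumes "continuous_on UNIV F" "e > 0" "j \<in> Basis"
  obtains M where "M \<ge> 0" "\<And>x s. x \<in> cbox 0 One \<Longrightarrow> 0 \<le> s \<Longrightarrow> s \<le> 1 \<Longrightarrow>
    norm (F (set_coord j s x) - F x) \<le> e + M * (s - x \<bullet> j)\<^sup>2"
proof -
  let ?Q = "cbox 0 One :: 'a set"
  have co: "continuous_on ?Q F" using assms(1) continuous_on_subset by blast
  then obtain d where d: "d > 0" "\<And>x y. x \<in> ?Q \<Longrightarrow> y \<in> ?Q \<Longrightarrow> dist y x < d \<Longrightarrow> dist (F y) (F x) < e"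
    using compact_uniformly_continuous[OF co] assms(2) unfolding uniformly_continuous_on_def
    by (metis compact_cbox)
  obtain B where B: "B > 0" "\<And>x. x \<in> ?Q \<Longrightarrow> norm (F x) \<le> B"
    using compact_imp_bounded[OF compact_continuous_image[OF co compact_cbox]]
    by (auto simp: bounded_pos)
  show thesis
  proof
    show "2 * B / d\<^sup>2 \<ge> 0" using B d by simp
    fix x s assume x: "x \<in> ?Q" and s: "0 \<le> s" "s \<le> (1::real)"
    have Q: "set_coord j s x \<in> ?Q" using set_coord_in_cube x s assms(3) by blast
    have D: "dist (set_coord j s x) x = \<bar>s - x \<bullet> j\<bar>"
      using assms(3) by (simp add: set_coord_def dist_norm)
    show "norm (F (set_coord j s x) - F x) \<le> e + 2 * B / d\<^sup>2 * (s - x \<bullet> j)\<^sup>2"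
    proof (cases "\<bar>s - x \<bullet> j\<bar> < d")
      case True
      then have "norm (F (set_coord j s x) - F x) < e" using d(2)[OF x Q] D by (simp add: dist_norm)
      moreover have "0 \<le> 2 * B / d\<^sup>2 * (s - x \<bullet> j)\<^sup>2" using B d by simp
      ultimately show ?thesis by linarith
    next
      case False
      then have "d\<^sup>2 \<le> (s - x \<bullet> j)\<^sup>2" using d(1) by (metis abs_le_square_iff abs_of_pos not_less)
      then have "2 * B / d\<^sup>2 * d\<^sup>2 \<le> 2 * B / d\<^sup>2 * (s - x \<bullet> j)\<^sup>2"
        using B d by (intro mult_left_mono) auto
      moreover have "norm (F (set_coord j s x) - F x) \<le> B + B"
        using norm_triangle_ineq4 B(2)[OF x] B(2)[OF Q] by (meson add_mono order_trans)
      ultimately show ?thesis using assms(2) d(1) by simp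
    qed
  qed
qed

text \<open>The mean value theorem along the direction \<open>j\<close>; it turns forward
  differences of values into values of the gradient, to which \<open>quadratic_modulus\<close>
  applies.\<close>

lemma slice_difference_quotient:
  assumes F: "C1_jet F" and j: "j \<in> Basis" and lt: "s < s'"
  obtains \<xi> where "s < \<xi>" "\<xi> < s'"
    "fst (F (set_coord j s' x)) - fst (F (set_coord j s x))
      = (s' - s) * (snd (F (set_coord j \<xi> x)) \<bullet> j)"
proof -
  have D: "((\<lambda>t. fst (F (set_coord j t x))) has_real_derivative snd (F (set_coord j t x)) \<bullet> j) (at t)" for t
  proof -
    have 1: "((\<lambda>t. set_coord j t x) has_derivative (\<lambda>h. h *\<^sub>R j)) (at t)"
      unfolding set_coord_def by (auto intro!: derivative_eq_intros)
    have "((\<lambda>y. fst (F y)) has_derivative (\<lambda>h. snd (F (set_coord j t x)) \<bullet> h)) (at (set_coord j t x))"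
      using F by (simp add: C1_jet_def)
    from has_derivative_compose[OF 1 this] show ?thesis
      by (simp add: has_field_derivative_def mult_commute_abs)
  qed
  have "\<exists>\<xi>>s. \<xi> < s' \<and> fst (F (set_coord j s' x)) - fst (F (set_coord j s x))
      = (s' - s) * (snd (F (set_coord j \<xi> x)) \<bullet> j)"
    by (rule MVT2[OF lt, of "\<lambda>t. fst (F (set_coord j t x))"]) (rule D)
  then show thesis by (elim exE conjE) (rule that)
qed

text \<open>Differentiation lowers the degree, so difference quotients live between nodes of degree
  \<open>Suc n\<close> while the weights have degree \<open>n\<close>. The node \<open>k / n\<close>
  lies in the same interval as \<xi>, whose length is \<open>1 / Suc n\<close>.\<close>

lemma Bernstein_nodes_close:
  assumes "n > 0" "k \<le> n" "real k / real (Suc n) < \<xi>" "\<xi> < real (Suc k) / real (Suc n)"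
  shows "\<bar>\<xi> - real k / real n\<bar> \<le> 1 / real (Suc n)"
proof -
  have "real k / real (Suc n) \<le> real k / real n" using assms(1) by (intro divide_left_mono) auto
  moreover have "real k / real n \<le> real (Suc k) / real (Suc n)"
    using assms(1,2) by (simp add: field_simps)
  moreover have "real (Suc k) / real (Suc n) = real k / real (Suc n) + 1 / real (Suc n)"
    by (simp add: field_simps)
  ultimately show ?thesis using assms(3,4) by linarith
qed

text \<open>The error splits into three parts: the value, the gradient orthogonal to
  \<open>j\<close>, and the gradient along \<open>j\<close>. The operator averages the first two
  directly over slices; the third becomes an average of difference quotients by summation by
  parts.\<close>

lemma C1_Bernstein_coordinate:
  fixes F :: "'a::euclidean_space \<Rightarrow> real \<times> 'a"
  assumes F: "C1_jet F" and j: "j \<in> Basis" and e: "e > 0"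
  obtains n where "\<And>x. x \<in> cbox 0 One \<Longrightarrow>
    norm (F x - (\<Sum>k\<le>Suc n. jet_mult (poly_jet (Bernstein_poly (Suc n) k) j x)
        (slice_jet F j (real k / real (Suc n)) x))) < e"
proof -
  obtain M where M: "M \<ge> 0" "\<And>x s. x \<in> cbox 0 One \<Longrightarrow> 0 \<le> s \<Longrightarrow> s \<le> 1 \<Longrightarrow>
    norm (F (set_coord j s x) - F x) \<le> e / 6 + M * (s - x \<bullet> j)\<^sup>2"
    using quadratic_modulus[OF C1_jet_continuous[OF F] _ j, of "e / 6"] e by auto
  \<comment> \<open>The three parts add up to at most \<open>3 * (e / 6)\<close> plus six terms of
    size at most \<open>M / n\<close>; making each of these smaller than \<open>e / 24\<close>
    leaves a total below \<open>3 * e / 4\<close>.\<close>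
  obtain n where n: "real n > 24 * M / e" "n > 0"
    using reals_Archimedean2[of "max 0 (24 * M / e)"] by auto
  have Mn: "M / real n < e / 24" using n e by (simp add: field_simps)
  have Mn': "M / real (Suc n) \<le> M / real n" using n(2) M(1) by (intro divide_left_mono) auto
  show thesis
  proof
    fix x :: 'a assume x: "x \<in> cbox 0 One"
    define t where "t = x \<bullet> j"
    have t: "0 \<le> t" "t \<le> 1" using x j by (auto simp: t_def mem_box)
    define y where "y k = set_coord j (real k / real (Suc n)) x" for k
    define P where "P v = v - (v \<bullet> j) *\<^sub>R j" for v
    have P: "norm (P v) \<le> norm v" for v
    proof -
      have "(norm (P v))\<^sup>2 = (norm v)\<^sup>2 - (v \<bullet> j)\<^sup>2"
        using j unfolding power2_norm_eq_inner P_def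
        by (simp add: inner_diff_left inner_diff_right inner_commute[of j v] power2_eq_square
            del: dot_square_norm)
      then have "(norm (P v))\<^sup>2 \<le> (norm v)\<^sup>2" by simp
      then show ?thesis by (rule power2_le_imp_le) simp
    qed
    have P_diff: "P (v - w) = P v - P w" for v w
      by (simp add: P_def inner_diff_left scaleR_diff_left)
    have Fk: "norm (F (y k) - F x) \<le> e / 6 + M * (real k / real (Suc n) - t)\<^sup>2" if "k \<le> Suc n" for k
      unfolding y_def t_def using that by (intro M(2) x) (auto simp: field_simps)
    have c1: "norm ((\<Sum>k\<le>Suc n. Bernstein (Suc n) k t *\<^sub>R fst (F (y k))) - fst (F x))
        \<le> e / 6 + M / real (Suc n)"
    proof (rule Bernstein_average[OF _ t M(1)])
      fix k assume "k \<le> Suc n"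
      have "norm (fst (F (y k)) - fst (F x)) \<le> norm (F (y k) - F x)"
        using norm_fst_snd_le(1)[of "F (y k) - F x"] by simp
      also note Fk[OF \<open>k \<le> Suc n\<close>]
      finally show "norm (fst (F (y k)) - fst (F x)) \<le> e / 6 + M * (real k / real (Suc n) - t)\<^sup>2" .
    qed simp
    have c2: "norm ((\<Sum>k\<le>Suc n. Bernstein (Suc n) k t *\<^sub>R P (snd (F (y k)))) - P (snd (F x)))
        \<le> e / 6 + M / real (Suc n)"
    proof (rule Bernstein_average[OF _ t M(1)])
      fix k assume "k \<le> Suc n"
      have "norm (P (snd (F (y k))) - P (snd (F x))) \<le> norm (snd (F (y k)) - snd (F x))"
        using P by (simp flip: P_diff)
      also have "\<dots> \<le> norm (F (y k) - F x)"
        using norm_fst_snd_le(2)[of "F (y k) - F x"] by simp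
      also note Fk[OF \<open>k \<le> Suc n\<close>]
      finally show "norm (P (snd (F (y k))) - P (snd (F x)))
        \<le> e / 6 + M * (real k / real (Suc n) - t)\<^sup>2" .
    qed simp
    \<comment> \<open>Each difference quotient is a gradient value at some \<xi> near
      \<open>k / n\<close>. Replacing \<xi> by \<open>k / n\<close> doubles \<open>M\<close> and
      adds \<open>2 * M / n\<close> to the constant part of the modulus; the other
      \<open>2 * M / n\<close> comes from the variance.\<close>
    have c3: "norm ((\<Sum>k\<le>n. Bernstein n k t *\<^sub>R (real (Suc n) * (fst (F (y (Suc k))) - fst (F (y k)))))
        - snd (F x) \<bullet> j) \<le> (e / 6 + 2 * M / real n) + 2 * M / real n"
    proof (rule Bernstein_average[OF n(2) t])
      show "0 \<le> 2 * M" using M(1) by simp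
      fix k assume k: "k \<le> n"
      have "real k / real (Suc n) < real (Suc k) / real (Suc n)" by (simp add: field_simps)
      then obtain \<xi> where \<xi>: "real k / real (Suc n) < \<xi>" "\<xi> < real (Suc k) / real (Suc n)"
        and q: "fst (F (y (Suc k))) - fst (F (y k))
          = (real (Suc k) / real (Suc n) - real k / real (Suc n)) * (snd (F (set_coord j \<xi> x)) \<bullet> j)"
        using slice_difference_quotient[OF F j, of _ _ x] unfolding y_def by metis
      have "real (Suc n) * (fst (F (y (Suc k))) - fst (F (y k))) = snd (F (set_coord j \<xi> x)) \<bullet> j"
        unfolding q by (simp add: field_simps)
      then have "norm (real (Suc n) * (fst (F (y (Suc k))) - fst (F (y k))) - snd (F x) \<bullet> j)
          = \<bar>(snd (F (set_coord j \<xi> x)) - snd (F x)) \<bullet> j\<bar>"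
        by (simp add: inner_diff_left)
      also have "\<dots> \<le> norm (snd (F (set_coord j \<xi> x)) - snd (F x))"
        using j by (rule Basis_le_norm)
      also have "\<dots> \<le> norm (F (set_coord j \<xi> x) - F x)"
        using norm_fst_snd_le(2)[of "F (set_coord j \<xi> x) - F x"] by simp
      also have "\<dots> \<le> e / 6 + M * (\<xi> - t)\<^sup>2"
      proof -
        have "0 \<le> real k / real (Suc n)" "real (Suc k) / real (Suc n) \<le> 1"
          using k by (auto simp: field_simps)
        then show ?thesis unfolding t_def using \<xi> by (intro M(2) x) linarith+
      qed
      \<comment> \<open>The square of a sum is at most twice the sum of the squares, applied to the
        distance from \<open>t\<close> to the node and the gap from the node to \<xi>.\<close>
      also have "M * (\<xi> - t)\<^sup>2 \<le> M * (2 * (real k / real n - t)\<^sup>2 + 2 / real n)"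
      proof (intro mult_left_mono M(1))
        define a where "a = real k / real n - t"
        define b where "b = \<xi> - real k / real n"
        have b: "\<bar>b\<bar> \<le> 1 / real (Suc n)"
          unfolding b_def by (rule Bernstein_nodes_close[OF n(2) k \<xi>])
        have "\<bar>b\<bar> \<le> 1" by (rule order_trans[OF b]) simp
        then have "\<bar>b\<bar> * \<bar>b\<bar> \<le> 1 / real (Suc n) * 1" using b by (intro mult_mono) auto
        then have "b\<^sup>2 \<le> 1 / real (Suc n)" by (simp add: power2_eq_square)
        also have "\<dots> \<le> 1 / real n" using n(2) by (intro divide_left_mono) auto
        finally have "b\<^sup>2 \<le> 1 / real n" .
        moreover have "(\<xi> - t)\<^sup>2 \<le> 2 * a\<^sup>2 + 2 * b\<^sup>2"
        proof -
          have "\<xi> - t = a + b" by (simp add: a_def b_def)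
          then show ?thesis
            using zero_le_power2[of "a - b"] by (simp add: power2_eq_square algebra_simps)
        qed
        ultimately show "(\<xi> - t)\<^sup>2 \<le> 2 * (real k / real n - t)\<^sup>2 + 2 / real n"
          unfolding a_def by simp
      qed
      finally show "norm (real (Suc n) * (fst (F (y (Suc k))) - fst (F (y k))) - snd (F x) \<bullet> j)
        \<le> e / 6 + 2 * M / real n + 2 * M * (real k / real n - t)\<^sup>2"
        by (simp add: algebra_simps)
    qed
    define B where "B = (\<Sum>k\<le>Suc n. jet_mult (poly_jet (Bernstein_poly (Suc n) k) j x)
        (slice_jet F j (real k / real (Suc n)) x))"
    have B1: "fst B = (\<Sum>k\<le>Suc n. Bernstein (Suc n) k t *\<^sub>R fst (F (y k)))"
      by (simp add: B_def fst_sum jet_mult_def poly_jet_def slice_jet_def poly_Bernstein_poly y_def t_def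
        del: sum.atMost_Suc)
    have "snd B = (\<Sum>k\<le>Suc n. Bernstein (Suc n) k t *\<^sub>R P (snd (F (y k))))
        + (\<Sum>k\<le>Suc n. fst (F (y k)) * poly (pderiv (Bernstein_poly (Suc n) k)) t) *\<^sub>R j"
      by (simp add: B_def snd_sum jet_mult_def poly_jet_def slice_jet_def poly_Bernstein_poly y_def t_def
        P_def sum.distrib scaleR_sum_left del: sum.atMost_Suc)
    then have B2: "snd B - snd (F x) = ((\<Sum>k\<le>Suc n. Bernstein (Suc n) k t *\<^sub>R P (snd (F (y k)))) - P (snd (F x)))
        + ((\<Sum>k\<le>n. Bernstein n k t *\<^sub>R (real (Suc n) * (fst (F (y (Suc k))) - fst (F (y k)))))
        - snd (F x) \<bullet> j) *\<^sub>R j"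
      unfolding sum_pderiv_Bernstein_poly
      by (simp add: P_def scaleR_diff_left del: sum.atMost_Suc)
    have "norm (snd B - snd (F x)) \<le> (e / 6 + M / real (Suc n)) + ((e / 6 + 2 * M / real n) + 2 * M / real n)"
      unfolding B2 using j by (intro order_trans[OF norm_triangle_ineq] add_mono c2) (simp only: norm_scaleR norm_Basis mult_1_right, rule c3[unfolded real_norm_def])
    moreover have "norm (fst B - fst (F x)) \<le> e / 6 + M / real (Suc n)"
      unfolding B1 by (rule c1)
    moreover have "norm (F x - B) \<le> norm (fst B - fst (F x)) + norm (snd B - snd (F x))"
      using norm_Pair_le[of "fst B - fst (F x)" "snd B - snd (F x)"]
      by (simp add: norm_minus_commute flip: minus_prod_def) 
    ultimately have "norm (F x - B) \<le> 3 * (e / 6) + 2 * (M / real (Suc n)) + 4 * (M / real n)"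
      by (simp add: add_divide_distrib)
    also have "\<dots> < e" using Mn Mn' e by linarith
    finally show "norm (F x - (\<Sum>k\<le>Suc n. jet_mult (poly_jet (Bernstein_poly (Suc n) k) j x)
        (slice_jet F j (real k / real (Suc n)) x))) < e" by (simp only: B_def)
  qed
qed

text \<open>Induction on the coordinates that the function depends on: the Bernstein operator in one
  coordinate removes it from the coefficients.\<close>

lemma C1_jet_in_exp_closure_aux:
  fixes F :: "'a::euclidean_space \<Rightarrow> real \<times> 'a"
  assumes "finite J" "J \<subseteq> Basis" "C1_jet F" "\<And>i x. i \<in> Basis - J \<Longrightarrow> snd (F x) \<bullet> i = 0"
  shows "F \<in> lin_closure (cbox 0 One) (range exp_jet)"
  using assms
proof (induction J arbitrary: F rule: finite_induct)
  case empty
  have z: "snd (F x) = 0" for x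
    by (rule euclidean_eqI) (simp add: empty.prems(3))
  have "\<exists>c. \<forall>x\<in>UNIV. fst (F x) = c"
  proof (rule has_derivative_zero_constant)
    show "((\<lambda>x. fst (F x)) has_derivative (\<lambda>h. 0)) (at x within UNIV)" for x
      using empty.prems(2) z by (simp add: C1_jet_def)
  qed auto
  then obtain c where "\<And>x. fst (F x) = c" by auto
  then have "F = (\<lambda>x. (c, 0))" by (simp add: fun_eq_iff prod_eq_iff z)
  then show ?case using const_jet_in_exp_closure by simp
next
  case (insert j J)
  have j: "j \<in> Basis" using insert.prems(1) by simp
  have slice: "slice_jet F j s \<in> lin_closure (cbox 0 One) (range exp_jet)" for s
  proof (rule insert.IH)
    show "C1_jet (slice_jet F j s)" by (rule C1_jet_slice[OF insert.prems(2)])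
    fix i x assume i: "i \<in> Basis - J"
    show "snd (slice_jet F j s x) \<bullet> i = 0"
      using i j insert.prems(3)[of i "set_coord j s x"]
      by (cases "i = j") (auto simp: slice_jet_def inner_diff_left inner_Basis)
  qed (use insert.prems in auto)
  show ?case
  proof (rule lin_closure.lim)
    fix e :: real assume "e > 0"
    then obtain n where n: "\<And>x. x \<in> cbox 0 One \<Longrightarrow>
      norm (F x - (\<Sum>k\<le>Suc n. jet_mult (poly_jet (Bernstein_poly (Suc n) k) j x)
        (slice_jet F j (real k / real (Suc n)) x))) < e"
      using C1_Bernstein_coordinate[OF insert.prems(2) j] by blast
    have "(\<lambda>x. \<Sum>k\<le>Suc n. jet_mult (poly_jet (Bernstein_poly (Suc n) k) j x)
        (slice_jet F j (real k / real (Suc n)) x)) \<in> lin_closure (cbox 0 One) (range exp_jet)"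
      by (intro lin_closure_sum exp_closure_mult slice poly_jet_in_exp_closure compact_cbox) auto
    with n show "\<exists>G. G \<in> lin_closure (cbox 0 One) (range exp_jet) \<and>
        (\<forall>x\<in>cbox 0 One. norm (F x - G x) < e)" by (intro exI conjI ballI)
  qed
qed

lemma C1_jet_in_tanh_closure:
  fixes F :: "'a::euclidean_space \<Rightarrow> real \<times> 'a"
  assumes "C1_jet F"
  shows "F \<in> lin_closure (cbox 0 One) (range (\<lambda>(a, b). tanh_jet a b))"
proof -
  have "range exp_jet \<subseteq> lin_closure (cbox 0 One :: 'a set) (range (\<lambda>(a, b). tanh_jet a b))"
    using exp_jet_in_tanh_closure bounded_cbox by blast
  moreover have "F \<in> lin_closure (cbox 0 One) (range exp_jet)"
    using assms by (intro C1_jet_in_exp_closure_aux[of Basis]) auto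
  ultimately show ?thesis using lin_closure_subset by blast
qed

section \<open>From the closure to finite networks\<close>

definition tanh_net :: "nat \<Rightarrow> (nat \<Rightarrow> 'a::real_inner) \<Rightarrow> (nat \<Rightarrow> real) \<Rightarrow> (nat \<Rightarrow> real) \<Rightarrow> 'a \<Rightarrow> real \<times> 'a" where
  "tanh_net m A b w x = (\<Sum>i<m. w i *\<^sub>R tanh_jet (A i) (b i) x)"

lemma sum_glue:
  fixes f g :: "nat \<Rightarrow> 'b::comm_monoid_add"
  shows "(\<Sum>i<m + n. if i < m then f i else g (i - m)) = sum f {..<m} + sum g {..<n}"
  by (induction n) (auto simp: add.assoc)

text \<open>Every closure rule has a counterpart on networks: scaling acts on the output weights, a
  sum concatenates two hidden layers, and a limit splits the tolerance in half.\<close>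

lemma tanh_closure_net:
  assumes "F \<in> lin_closure K (range (\<lambda>(a, b). tanh_jet a b))" "e > 0"
  shows "\<exists>m A b w. \<forall>x\<in>K. norm (F x - tanh_net m A b w x) < e"
  using assms
proof (induction arbitrary: e)
  case (base F)
  then obtain a b where "F = tanh_jet a b" by auto
  then have "\<forall>x\<in>K. norm (F x - tanh_net 1 (\<lambda>_. a) (\<lambda>_. b) (\<lambda>_. 1) x) < e"
    using base by (simp add: tanh_net_def)
  then show ?case by (intro exI)
next
  case (scale F c)
  \<comment> \<open>Adding 1 to the denominator covers \<open>c = 0\<close>.\<close>
  have "e / (\<bar>c\<bar> + 1) > 0" using scale.prems by simp
  then obtain m A b w where N: "\<forall>x\<in>K. norm (F x - tanh_net m A b w x) < e / (\<bar>c\<bar> + 1)"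
    using scale.IH by blast
  have "norm (c *\<^sub>R F x - tanh_net m A b (\<lambda>i. c * w i) x) < e" if "x \<in> K" for x
  proof -
    have "c *\<^sub>R F x - tanh_net m A b (\<lambda>i. c * w i) x = c *\<^sub>R (F x - tanh_net m A b w x)"
      by (simp add: tanh_net_def scaleR_diff_right scaleR_sum_right)
    then have "norm (c *\<^sub>R F x - tanh_net m A b (\<lambda>i. c * w i) x)
        = \<bar>c\<bar> * norm (F x - tanh_net m A b w x)" by simp
    also have "\<dots> \<le> \<bar>c\<bar> * (e / (\<bar>c\<bar> + 1))"
      using N that by (intro mult_left_mono) (auto intro: less_imp_le)
    also have "\<dots> < e" using scale.prems by (simp add: field_simps)
    finally show ?thesis .
  qed
  then show ?case by (intro exI ballI)
next
  case (add F G)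
  have "e / 2 > 0" using add.prems by simp
  then obtain m A b w m' A' b' w' where N: "\<forall>x\<in>K. norm (F x - tanh_net m A b w x) < e / 2"
    and N': "\<forall>x\<in>K. norm (G x - tanh_net m' A' b' w' x) < e / 2"
    using add.IH by meson
  define A'' where "A'' i = (if i < m then A i else A' (i - m))" for i
  define b'' where "b'' i = (if i < m then b i else b' (i - m))" for i
  define w'' where "w'' i = (if i < m then w i else w' (i - m))" for i
  have net: "tanh_net (m + m') A'' b'' w'' x = tanh_net m A b w x + tanh_net m' A' b' w' x" for x
    unfolding tanh_net_def sum_glue[symmetric] A''_def b''_def w''_def
    by (intro sum.cong) auto
  have "norm (F x + G x - tanh_net (m + m') A'' b'' w'' x) < e" if "x \<in> K" for x
    unfolding net using norm_diff_triangle_ineq[of "F x" "G x" "tanh_net m A b w x" "tanh_net m' A' b' w' x"]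
      bspec[OF N that] bspec[OF N' that]
    by linarith
  then show ?case by (intro exI ballI)
next
  case (lim F)
  have e: "e / 2 > 0" using lim.prems by simp
  obtain G where G: "\<forall>x\<in>K. norm (F x - G x) < e / 2"
    and IH: "\<And>e. e > 0 \<Longrightarrow> \<exists>m A b w. \<forall>x\<in>K. norm (G x - tanh_net m A b w x) < e"
    using lim.IH[OF e] by blast
  obtain m A b w where N: "\<forall>x\<in>K. norm (G x - tanh_net m A b w x) < e / 2"
    using IH[OF e] by blast
  have "norm (F x - tanh_net m A b w x) < e" if "x \<in> K" for x
    using norm_diff_triangle_less[OF bspec[OF G that] bspec[OF N that]] by simp
  then show ?case by (intro exI ballI)
qed

text \<open>The unit cube is carried onto a cube containing \<open>K\<close> by the affine map
  \<phi>; the inverse map is absorbed into the weights and biases of the network.\<close>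

theorem tanh_net_C1_dense:
  fixes F :: "'a::euclidean_space \<Rightarrow> real \<times> 'a"
  assumes F: "C1_jet F" and K: "bounded K" and e: "e > 0"
  shows "\<exists>m\<ge>1. \<exists>A b w. \<forall>x\<in>K. norm (F x - tanh_net m A b w x) < e"
proof -
  obtain R0 where R0: "\<And>x. x \<in> K \<Longrightarrow> norm x \<le> R0" using K by (auto simp: bounded_iff)
  \<comment> \<open>With \<open>R\<close> at least 1, undoing the scaling multiplies gradient errors
    by \<open>1 / (2 * R)\<close>, which is below 1, so the tolerance is preserved.\<close>
  define R where "R = max 1 R0"
  have R: "R \<ge> 1" "\<And>x. x \<in> K \<Longrightarrow> norm x \<le> R" using R0 by (auto simp: R_def le_max_iff_disj)
  define \<phi> where "\<phi> y = (2 * R) *\<^sub>R y - R *\<^sub>R One" for y :: 'a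
  define G where "G y = (fst (F (\<phi> y)), (2 * R) *\<^sub>R snd (F (\<phi> y)))" for y
  have "C1_jet G"
    unfolding C1_jet_def
  proof (intro conjI allI)
    fix y
    have 1: "(\<phi> has_derivative (\<lambda>h. (2 * R) *\<^sub>R h)) (at y)"
      unfolding \<phi>_def by (auto intro!: derivative_eq_intros)
    have "((\<lambda>x. fst (F x)) has_derivative (\<lambda>h. snd (F (\<phi> y)) \<bullet> h)) (at (\<phi> y))"
      using F by (simp add: C1_jet_def)
    from has_derivative_compose[OF 1 this]
    have "((\<lambda>x. fst (G x)) has_derivative (\<lambda>h. snd (F (\<phi> y)) \<bullet> ((2 * R) *\<^sub>R h))) (at y)"
      by (simp only: G_def fst_conv)
    moreover have "(\<lambda>h. snd (F (\<phi> y)) \<bullet> ((2 * R) *\<^sub>R h)) = (\<bullet>) (snd (G y))"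
      by (simp add: fun_eq_iff G_def)
    ultimately show "((\<lambda>x. fst (G x)) has_derivative (\<bullet>) (snd (G y))) (at y)"
      by (simp only:)
  next
    have "continuous_on UNIV (\<lambda>y. snd (F (\<phi> y)))"
    proof (rule continuous_on_compose2[of UNIV "\<lambda>x. snd (F x)"])
      show "continuous_on UNIV \<phi>" unfolding \<phi>_def by (intro continuous_intros)
    qed (use F in \<open>auto simp: C1_jet_def\<close>)
    then show "continuous_on UNIV (\<lambda>x. snd (G x))"
      unfolding G_def snd_conv by (rule continuous_on_scaleR[OF continuous_on_const])
  qed
  then have "\<exists>m A b w. \<forall>y\<in>cbox 0 One. norm (G y - tanh_net m A b w y) < e"
    by (intro tanh_closure_net[OF _ e] C1_jet_in_tanh_closure)
  then obtain m A b w where N: "\<forall>y\<in>cbox 0 One. norm (G y - tanh_net m A b w y) < e"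
    by (elim exE)
  \<comment> \<open>One idle unit is appended, so that the width is at least 1 even when the closure
    argument returns the empty network.\<close>
  define A' where "A' i = (if i < m then A i /\<^sub>R (2 * R) else 0)" for i
  define b' where "b' i = A i \<bullet> One / 2 + b i" for i
  define w' where "w' i = (if i < m then w i else 0)" for i
  have "norm (F x - tanh_net (Suc m) A' b' w' x) < e" if x: "x \<in> K" for x
  proof -
    define y where "y = (1 / (2 * R)) *\<^sub>R (x + R *\<^sub>R One)"
    have \<phi>y: "\<phi> y = x" using R(1) by (simp add: \<phi>_def y_def)
    have "y \<in> cbox 0 One"
    proof -
      have "0 \<le> y \<bullet> i \<and> y \<bullet> i \<le> 1" if "i \<in> Basis" for i
      proof -
        have "\<bar>x \<bullet> i\<bar> \<le> R" using Basis_le_norm[OF that] R(2)[OF x] by (rule order_trans)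
        then have "0 \<le> x \<bullet> i + R" "x \<bullet> i + R \<le> 2 * R" by linarith+
        moreover have "y \<bullet> i = (x \<bullet> i + R) / (2 * R)"
          using that by (simp add: y_def inner_add_left)
        ultimately show ?thesis using R(1) by (simp add: divide_le_eq)
      qed
      then show ?thesis by (simp add: mem_box)
    qed
    define N where "N = tanh_net m A b w y"
    have "norm (G y - N) < e" using N \<open>y \<in> cbox 0 One\<close> by (simp add: N_def)
    have arg: "A i \<bullet> y + b i = A' i \<bullet> x + b' i" if "i < m" for i
      using R(1) that by (simp add: y_def A'_def b'_def inner_add_right field_simps)
    have N1: "fst (tanh_net (Suc m) A' b' w' x) = fst N"
      by (simp add: tanh_net_def N_def fst_sum w'_def tanh_jet_def arg)
    have N2: "snd (tanh_net (Suc m) A' b' w' x) = snd N /\<^sub>R (2 * R)"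
      using R(1) by (simp add: tanh_net_def N_def snd_sum w'_def tanh_jet_def arg scaleR_sum_right A'_def mult_ac)
    have "snd (F x) = snd (G y) /\<^sub>R (2 * R)" using R(1) by (simp add: G_def \<phi>y)
    then have "F x - tanh_net (Suc m) A' b' w' x
        = (fst (G y) - fst N, (snd (G y) - snd N) /\<^sub>R (2 * R))"
      by (simp add: prod_eq_iff N1 N2 G_def \<phi>y scaleR_diff_right)
    then have "norm (F x - tanh_net (Suc m) A' b' w' x)
        = sqrt ((fst (G y) - fst N)\<^sup>2 + (norm ((snd (G y) - snd N) /\<^sub>R (2 * R)))\<^sup>2)"
      by (simp only: norm_Pair real_norm_def power2_abs)
    also have "\<dots> \<le> sqrt ((fst (G y) - fst N)\<^sup>2 + (norm (snd (G y) - snd N))\<^sup>2)"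
    proof (intro real_sqrt_le_mono add_left_mono power_mono)
      have "\<bar>inverse (2 * R)\<bar> \<le> 1"
        using R(1) le_imp_inverse_le[of 1 "2 * R"] by (simp only: abs_of_nonneg inverse_1) simp
      then show "norm ((snd (G y) - snd N) /\<^sub>R (2 * R)) \<le> norm (snd (G y) - snd N)"
        unfolding norm_scaleR by (intro mult_left_le_one_le) auto
    qed simp
    also have "\<dots> = norm (G y - N)"
      by (simp add: norm_prod_def)
    also have "\<dots> < e" by fact
    finally show ?thesis .
  qed
  then show ?thesis by (intro exI[of _ "Suc m"] conjI exI ballI) auto
qed

subsection \<open>Calculus of \<open>C\<^sup>k\<close> functions\<close>

lemma frechet_derivative_eq:
  "(f has_derivative f') (at x) \<Longrightarrow> frechet_derivative f (at x) = f'"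
  using frechet_derivative_at by metis

lemma frechet_derivative_cong_open:
  assumes "open S" "x \<in> S" "\<And>y. y \<in> S \<Longrightarrow> f y = g y"
  shows "frechet_derivative f (at x) = frechet_derivative g (at x)"
proof -
  have "(f has_derivative f') (at x) \<longleftrightarrow> (g has_derivative f') (at x)" for f'
    using assms has_derivative_transform_within_open[of _ _ x UNIV S] by metis
  then show ?thesis unfolding frechet_derivative_def by simp
qed

lemma Ck_on_cong:
  assumes "open S" "\<And>x. x \<in> S \<Longrightarrow> f x = g x" "Ck_on k S f"
  shows "Ck_on k S g"
  using assms(2,3)
proof (induction k arbitrary: f g)
  case 0
  then show ?case by (simp cong: continuous_on_cong)
next
  case (Suc k)
  have "g differentiable (at x)" if "x \<in> S" for x
    using Suc.prems assms(1) that has_derivative_transform_within_open[of f _ x UNIV S g]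
    unfolding Ck_on.simps differentiable_def by metis
  moreover have "Ck_on k S (\<lambda>x. frechet_derivative g (at x) v)" for v
  proof (rule Suc.IH)
    show "Ck_on k S (\<lambda>x. frechet_derivative f (at x) v)" using Suc.prems(2) by simp
    show "frechet_derivative f (at x) v = frechet_derivative g (at x) v" if "x \<in> S" for x
      using frechet_derivative_cong_open[OF assms(1) that, of f g] Suc.prems(1) by simp
  qed
  ultimately show ?case by simp
qed

text \<open>Lets the recursion run on explicit derivative formulas in place of
  \<open>frechet_derivative\<close>; openness of \<open>S\<close> makes the two interchangeable in
  the higher derivatives.\<close>

lemma Ck_on_SucI:
  assumes "open S" "\<And>x. x \<in> S \<Longrightarrow> (f has_derivative f' x) (at x)"
    and "\<And>v. Ck_on k S (\<lambda>x. f' x v)"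
  shows "Ck_on (Suc k) S f"
proof -
  have "Ck_on k S (\<lambda>x. frechet_derivative f (at x) v)" for v
    by (rule Ck_on_cong[OF assms(1) _ assms(3)[of v]])
      (simp add: frechet_derivative_eq[OF assms(2)])
  then show ?thesis using assms(2) by (auto simp: differentiable_def)
qed

lemma Ck_on_Suc_imp:
  assumes "Ck_on (Suc k) S f"
  shows "Ck_on k S f"
  using assms
proof (induction k arbitrary: f)
  case 0
  then show ?case
    by (auto intro!: continuous_at_imp_continuous_on differentiable_imp_continuous_within)
next
  case (Suc k)
  then show ?case unfolding Ck_on.simps(2)[of "Suc k"] Ck_on.simps(2)[of k S f] by blast
qed

lemma Ck_on_SucE:
  assumes "Ck_on (Suc k) S f"
  shows "\<And>x. x \<in> S \<Longrightarrow> (f has_derivative frechet_derivative f (at x)) (at x)"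
    and "\<And>v. Ck_on k S (\<lambda>x. frechet_derivative f (at x) v)"
  using assms by (auto simp flip: frechet_derivative_works)

lemma Ck_on_const:
  assumes "open S"
  shows "Ck_on k S (\<lambda>x. c)"
proof (induction k arbitrary: c)
  case (Suc k)
  show ?case by (rule Ck_on_SucI[OF assms, of _ "\<lambda>_ _. 0"]) (use Suc in auto)
qed simp

lemma Ck_on_bounded_linear:
  assumes "open S" "bounded_linear f"
  shows "Ck_on k S f"
proof (cases k)
  case 0
  then show ?thesis using assms(2) by (simp add: linear_continuous_on)
next
  case (Suc l)
  show ?thesis unfolding Suc
    by (rule Ck_on_SucI[OF assms(1), of _ "\<lambda>_. f"])
      (auto intro: bounded_linear_imp_has_derivative Ck_on_const assms)
qed

lemma Ck_on_add:
  assumes "open S" "Ck_on k S f" "Ck_on k S g"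
  shows "Ck_on k S (\<lambda>x. f x + g x)"
  using assms(2,3)
proof (induction k arbitrary: f g)
  case 0
  then show ?case by (auto intro: continuous_on_add)
next
  case (Suc k)
  note f = Ck_on_SucE[OF Suc.prems(1)] and g = Ck_on_SucE[OF Suc.prems(2)]
  show ?case
    by (rule Ck_on_SucI[OF assms(1) has_derivative_add[OF f(1) g(1)]]) (auto intro: Suc.IH f g)
qed

lemma Ck_on_mult:
  fixes f g :: "'a::euclidean_space \<Rightarrow> real"
  assumes "open S" "Ck_on k S f" "Ck_on k S g"
  shows "Ck_on k S (\<lambda>x. f x * g x)"
  using assms(2,3)
proof (induction k arbitrary: f g)
  case 0
  then show ?case by (auto intro: continuous_on_mult)
next
  case (Suc k)
  note f = Ck_on_SucE[OF Suc.prems(1)] and g = Ck_on_SucE[OF Suc.prems(2)]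
  show ?case
    by (rule Ck_on_SucI[OF assms(1) has_derivative_mult[OF f(1) g(1)]])
      (intro Suc.IH Ck_on_add[OF assms(1)] f(2) g(2) Suc.prems[THEN Ck_on_Suc_imp] | assumption)+
qed

lemma Ck_on_sum:
  fixes f :: "'i \<Rightarrow> 'a::euclidean_space \<Rightarrow> 'b::real_normed_vector"
  assumes "open S" "finite I" "\<And>i. i \<in> I \<Longrightarrow> Ck_on k S (f i)"
  shows "Ck_on k S (\<lambda>x. \<Sum>i\<in>I. f i x)"
  using assms(2,3)
proof (induction I rule: finite_induct)
  case empty
  then show ?case by (simp add: Ck_on_const assms(1))
next
  case (insert i I)
  then show ?case by (simp add: Ck_on_add[OF assms(1)])
qed

text \<open>The derivative contains \<open>exp (f x)\<close> itself, which the induction hypothesis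
  covers one order lower.\<close>

lemma Ck_on_exp:
  fixes f :: "'a::euclidean_space \<Rightarrow> real"
  assumes "open S" "Ck_on k S f"
  shows "Ck_on k S (\<lambda>x. exp (f x))"
  using assms(2)
proof (induction k)
  case 0
  then show ?case by (auto intro: continuous_on_exp)
next
  case (Suc k)
  note f = Ck_on_SucE[OF Suc.prems]
  show ?case
    by (rule Ck_on_SucI[OF assms(1) DERIV_compose_FDERIV[OF DERIV_exp f(1)]])
      (intro Ck_on_mult[OF assms(1)] f(2) Suc.IH Suc.prems[THEN Ck_on_Suc_imp] | assumption)+
qed

lemma Ck_on_tanh:
  fixes f :: "'a::euclidean_space \<Rightarrow> real"
  assumes "open S" "Ck_on k S f"
  shows "Ck_on k S (\<lambda>x. tanh (f x))"
  using assms(2)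
proof (induction k)
  case 0
  then show ?case by (auto intro: continuous_on_tanh)
next
  case (Suc k)
  note f = Ck_on_SucE[OF Suc.prems]
  \<comment> \<open>The equation \<open>tanh' = 1 - tanh\<^sup>2\<close> closes the induction; it is
    written with sums, products and constants only, to match the closure rules of
    \<open>Ck_on\<close>.\<close>
  have t: "(tanh has_real_derivative 1 + (-1) * (tanh y * tanh y)) (at y)" for y :: real
    by (auto intro!: derivative_eq_intros simp: power2_eq_square)
  show ?case
    by (rule Ck_on_SucI[OF assms(1) DERIV_compose_FDERIV[OF t f(1)]])
      (intro Ck_on_mult[OF assms(1)] Ck_on_add[OF assms(1)] Ck_on_const[OF assms(1)] f(2) Suc.IH
        Suc.prems[THEN Ck_on_Suc_imp] | assumption)+
qed

lemma has_derivative_norm_at: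
  fixes x :: "'a::real_inner"
  assumes "x \<noteq> 0"
  shows "(norm has_derivative (\<lambda>h. inverse (norm x) * (x \<bullet> h))) (at x)"
  using has_derivative_norm[OF assms] by (simp add: sgn_div_norm inner_commute)

text \<open>The derivative is minus the cube of the function times the linear factor
  \<open>x \<bullet> h\<close>, so the function reproduces itself and the induction closes.\<close>

lemma Ck_on_inverse_norm:
  "Ck_on k (UNIV - {0 :: 'a::euclidean_space}) (\<lambda>x. inverse (norm x))"
proof (induction k)
  case 0
  then show ?case by (auto intro!: continuous_intros)
next
  case (Suc k)
  have o: "open (UNIV - {0 :: 'a})" by (simp add: open_delete)
  let ?R = "\<lambda>x :: 'a. inverse (norm x)"
  have "(?R has_derivative (\<lambda>h. - 1 * (?R x * (?R x * ?R x)) * (x \<bullet> h))) (at x)"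
    if "x \<in> UNIV - {0}" for x
  proof -
    have "(?R has_derivative (\<lambda>h. - (?R x * (?R x * (x \<bullet> h)) * ?R x))) (at x)"
      using that by (intro Deriv.has_derivative_inverse[where f = norm] has_derivative_norm_at) auto
    then show ?thesis by (simp add: mult_ac)
  qed
  then show ?case
  proof (rule Ck_on_SucI[OF o])
    fix v :: 'a
    show "Ck_on k (UNIV - {0}) (\<lambda>x. - 1 * (?R x * (?R x * ?R x)) * (x \<bullet> v))"
      by (intro Ck_on_mult[OF o] Ck_on_const[OF o] Suc.IH
          Ck_on_bounded_linear[OF o bounded_linear_inner_left])
  qed
qed

lemma Ck_on_ln_norm:
  "Ck_on k (UNIV - {0 :: 'a::euclidean_space}) (\<lambda>x. ln (norm x))"
proof (cases k)
  case 0
  then show ?thesis by (auto intro!: continuous_intros)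
next
  case (Suc l)
  have o: "open (UNIV - {0 :: 'a})" by (simp add: open_delete)
  have d: "((\<lambda>x. ln (norm x)) has_derivative
      (\<lambda>h. (inverse (norm x) * (x \<bullet> h)) * inverse (norm x))) (at x)"
    if "x \<in> UNIV - {0}" for x :: 'a
    using that by (intro DERIV_compose_FDERIV[OF _ has_derivative_norm_at] DERIV_ln) auto
  show ?thesis unfolding Suc
    by (rule Ck_on_SucI[OF o d])
      (intro Ck_on_mult[OF o] Ck_on_inverse_norm Ck_on_bounded_linear[OF o bounded_linear_inner_left]
        | assumption)+
qed

text \<open>Away from the origin \<open>norm x powr p\<close> is
  \<open>exp (p * ln (norm x))\<close>, so the whole function is composed of operations already
  known to preserve \<open>Ck_on\<close>.\<close>

lemma Vhat_smooth:
  fixes A :: "nat \<Rightarrow> real^'n"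
  shows "smooth_on (UNIV - {0}) (Vhat p m A b w)"
  unfolding smooth_on_def
proof
  fix k
  have o: "open (UNIV - {0 :: real^'n})" by (simp add: open_delete)
  have "Ck_on k (UNIV - {0}) (\<lambda>x. exp (p * ln (norm x)
      + (\<Sum>i<m. w i * tanh (inverse (norm x) * (A i \<bullet> x) + b i))))"
    by (intro Ck_on_exp[OF o] Ck_on_add[OF o] Ck_on_mult[OF o] Ck_on_sum[OF o] Ck_on_tanh[OF o]
        Ck_on_const[OF o] Ck_on_ln_norm Ck_on_inverse_norm
        Ck_on_bounded_linear[OF o bounded_linear_inner_right]) auto
  then show "Ck_on k (UNIV - {0}) (Vhat p m A b w)"
    by (rule Ck_on_cong[OF o, rotated]) (simp add: Vhat_def powr_def exp_add mult.commute)
qed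

subsection \<open>Homogeneous functions\<close>

text \<open>Differentiating the identity \<open>F y = r powr p * F (y /\<^sub>R r)\<close> at
  \<open>r *\<^sub>R x\<close>: the inner scaling costs one power of \<open>r\<close>.\<close>

lemma frechet_derivative_homogeneous:
  fixes F :: "'a::real_normed_vector \<Rightarrow> real"
  assumes F: "homogeneous p F" "F differentiable (at x)" and r: "r > 0"
  shows "(F has_derivative (\<lambda>h. r powr (p - 1) * frechet_derivative F (at x) h)) (at (r *\<^sub>R x))"
proof -
  let ?D = "frechet_derivative F (at x)"
  have D: "(F has_derivative ?D) (at x)" using F(2) frechet_derivative_works by blast
  have 1: "((\<lambda>y. y /\<^sub>R r) has_derivative (\<lambda>h. h /\<^sub>R r)) (at (r *\<^sub>R x))"
    by (auto intro!: derivative_eq_intros)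
  have "((\<lambda>y. F (y /\<^sub>R r)) has_derivative (\<lambda>h. ?D (h /\<^sub>R r))) (at (r *\<^sub>R x))"
    using has_derivative_compose[OF 1, of F ?D] D r by simp
  then have "((\<lambda>y. r powr p * F (y /\<^sub>R r)) has_derivative (\<lambda>h. r powr p * ?D (h /\<^sub>R r))) (at (r *\<^sub>R x))"
    by (rule has_derivative_mult_right)
  moreover have "r powr p * F (y /\<^sub>R r) = F y" for y
  proof -
    have "F (r *\<^sub>R (y /\<^sub>R r)) = r powr p * F (y /\<^sub>R r)"
      using F(1) r by (simp only: homogeneous_def real_scaleR_def)
    then show ?thesis using r by simp
  qed
  moreover have "r powr p * ?D (h /\<^sub>R r) = r powr (p - 1) * ?D h" for h
    using linear_cmul[OF has_derivative_linear[OF D], of "inverse r" h] r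
    by (simp add: powr_diff field_simps)
  ultimately show ?thesis by simp
qed

lemma homogeneous_at_0:
  fixes F :: "'a::real_normed_vector \<Rightarrow> real"
  assumes "homogeneous p F" "p > 0"
  shows "F 0 = 0"
proof -
  have "\<forall>r>0. F (r *\<^sub>R 0) = (r powr p) *\<^sub>R F 0" using assms(1) unfolding homogeneous_def by (rule spec)
  then have "F 0 = 2 powr p * F 0" by (simp only: scaleR_zero_right real_scaleR_def zero_less_numeral)
  moreover have "(2 :: real) powr p > 1" using assms(2) by simp
  ultimately show ?thesis using assms(2) by simp
qed

text \<open>The constant is a bound on the compact unit sphere. Homogeneity is asked for at nonzero
  points only, so that the lemma also serves the directional derivatives of a function known to be
  C1 away from 0.\<close>

lemma homogeneous_bound:
  fixes F :: "'a::euclidean_space \<Rightarrow> real"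
  assumes hom: "\<And>x r. x \<noteq> 0 \<Longrightarrow> r > 0 \<Longrightarrow> F (r *\<^sub>R x) = r powr q * F x"
    and cont: "continuous_on (UNIV - {0}) F"
  shows "\<exists>C>0. \<forall>x. x \<noteq> 0 \<longrightarrow> \<bar>F x\<bar> \<le> C * norm x powr q"
proof -
  have "bounded (F ` sphere 0 1)"
    by (intro compact_imp_bounded compact_continuous_image continuous_on_subset[OF cont]) auto
  then obtain C where C: "C > 0" "\<And>u. norm u = 1 \<Longrightarrow> \<bar>F u\<bar> \<le> C" by (auto simp: bounded_pos)
  have "\<bar>F x\<bar> \<le> C * norm x powr q" if "x \<noteq> 0" for x
  proof -
    have "F x = norm x powr q * F (x /\<^sub>R norm x)"
      using hom[of "x /\<^sub>R norm x" "norm x"] that by simp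
    then show ?thesis using C(2)[of "x /\<^sub>R norm x"] that
      by (simp add: abs_mult mult.commute mult_right_mono)
  qed
  with C(1) show ?thesis by blast
qed

lemma tendsto_norm_powr_0:
  assumes "q > 0"
  shows "((\<lambda>x::'a::real_normed_vector. C * norm x powr q) \<longlongrightarrow> 0) (at 0)"
proof -
  have "((\<lambda>x::'a. norm x powr q) \<longlongrightarrow> 0) (at 0)"
    by (rule tendsto_zero_powrI[OF _ tendsto_const]) (auto intro!: tendsto_eq_intros assms)
  from tendsto_mult_right_zero[OF this] show ?thesis .
qed

text \<open>Near the origin both \<open>\<bar>F x\<bar> / norm x\<close> and the directional
  derivatives are of order \<open>norm x powr (p - 1)\<close>. Since \<open>p > 1\<close> this tends
  to 0, so the derivative at the origin is 0 and is attained continuously.\<close>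

lemma homogeneous_C1:
  fixes F :: "'a::euclidean_space \<Rightarrow> real"
  assumes p: "p > 1" and F: "homogeneous p F" and C1: "Ck_on 1 (UNIV - {0}) F"
  shows "Ck_on 1 UNIV F"
proof -
  have o: "open (UNIV - {0 :: 'a})" by (simp add: open_delete)
  have F0: "F 0 = 0" using homogeneous_at_0 F p by force
  have diff: "F differentiable (at x)" if "x \<noteq> 0" for x
    using C1 that by simp
  have cF: "continuous_on (UNIV - {0}) F"
    using Ck_on_Suc_imp[of 0 "UNIV - {0}" F] C1 by simp
  have hom: "F (r *\<^sub>R x) = r powr p * F x" if "x \<noteq> 0" "r > 0" for x r
    using F that by (simp add: homogeneous_def)
  have "\<exists>C>0. \<forall>x. x \<noteq> 0 \<longrightarrow> \<bar>F x\<bar> \<le> C * norm x powr p"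
    by (rule homogeneous_bound[OF hom cF])
  then obtain C where C: "C > 0" "\<And>x. x \<noteq> 0 \<Longrightarrow> \<bar>F x\<bar> \<le> C * norm x powr p"
    by blast
  have D0: "(F has_derivative (\<lambda>h. 0)) (at 0)"
    unfolding has_derivative_def
  proof (intro conjI bounded_linear_zero)
    have "((\<lambda>y. (F y - F 0 - 0) /\<^sub>R norm (y - 0)) \<longlongrightarrow> 0) (at 0)"
    proof (rule Lim_null_comparison)
      show "\<forall>\<^sub>F y in at 0. norm ((F y - F 0 - 0) /\<^sub>R norm (y - 0)) \<le> C * norm y powr (p - 1)"
        unfolding eventually_at_filter
      proof (intro always_eventually allI impI)
        fix y :: 'a assume "y \<noteq> 0"
        then show "norm ((F y - F 0 - 0) /\<^sub>R norm (y - 0)) \<le> C * norm y powr (p - 1)"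
          using C(2)[of y] by (simp add: F0 powr_diff field_simps)
      qed
      show "((\<lambda>y::'a. C * norm y powr (p - 1)) \<longlongrightarrow> 0) (at 0)"
        by (rule tendsto_norm_powr_0) (use p in simp)
    qed
    then show "((\<lambda>y. (F y - F (netlimit (at 0)) - 0) /\<^sub>R norm (y - netlimit (at 0))) \<longlongrightarrow> 0) (at 0)"
      by (simp add: netlimit_at)
  qed
  have "continuous_on UNIV (\<lambda>x. frechet_derivative F (at x) v)" for v
  proof -
    let ?G = "\<lambda>x. frechet_derivative F (at x) v"
    have cG: "continuous_on (UNIV - {0}) ?G" using C1 by simp
    have homG: "?G (r *\<^sub>R x) = r powr (p - 1) * ?G x" if "x \<noteq> 0" "r > 0" for x r
      using frechet_derivative_eq[OF frechet_derivative_homogeneous[OF F diff]] that by simp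
    have "\<exists>C>0. \<forall>x. x \<noteq> 0 \<longrightarrow> \<bar>?G x\<bar> \<le> C * norm x powr (p - 1)"
      by (rule homogeneous_bound[OF homG cG])
    then obtain C where C: "C > 0" "\<And>x. x \<noteq> 0 \<Longrightarrow> \<bar>?G x\<bar> \<le> C * norm x powr (p - 1)"
      by blast
    have "(?G \<longlongrightarrow> ?G 0) (at 0)"
      unfolding frechet_derivative_eq[OF D0]
    proof (rule Lim_null_comparison)
      show "\<forall>\<^sub>F x in at 0. norm (?G x) \<le> C * norm x powr (p - 1)"
        unfolding eventually_at_filter using C(2) by simp
      show "((\<lambda>x::'a. C * norm x powr (p - 1)) \<longlongrightarrow> 0) (at 0)"
        by (rule tendsto_norm_powr_0) (use p in simp)
    qed
    then have "isCont ?G 0" by (simp add: isCont_def)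
    moreover have "isCont ?G x" if "x \<noteq> 0" for x
      using cG o that by (simp add: continuous_on_eq_continuous_at)
    ultimately show ?thesis by (metis continuous_at_imp_continuous_on)
  qed
  moreover have "F differentiable (at x)" for x
    using diff D0 unfolding differentiable_def by (cases "x = 0") auto
  ultimately show ?thesis by simp
qed

section \<open>Properties of \<open>Vhat\<close> for arbitrary parameters\<close>

text \<open>As \<open>tanh\<close> stays between -1 and 1, the exponent is at least minus the sum of
  the absolute output weights. The resulting growth makes sublevel sets bounded.\<close>

lemma Vhat_bounds:
  assumes "x \<noteq> 0"
  shows "norm x powr p * exp (- (\<Sum>i<m. \<bar>w i\<bar>)) \<le> Vhat p m A b w x"
proof -
  have "\<bar>\<Sum>i<m. w i * tanh (A i \<bullet> (x /\<^sub>R norm x) + b i)\<bar> \<le> (\<Sum>i<m. \<bar>w i\<bar>)"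
    by (rule order_trans[OF sum_abs sum_mono])
      (simp add: abs_mult mult_left_le abs_le_iff less_imp_le[OF tanh_real_lt_1]
        less_imp_le[OF tanh_real_gt_neg1] minus_le_iff)
  then show ?thesis using assms by (simp add: Vhat_def abs_le_iff)
qed

lemma Vhat_pos: "x \<noteq> 0 \<Longrightarrow> 0 < Vhat p m A b w x"
  by (simp add: Vhat_def)

lemma Vhat_homogeneous: "homogeneous p (Vhat p m A b w)"
proof -
  have "Vhat p m A b w (r *\<^sub>R x) = r powr p * Vhat p m A b w x" if "r > 0" for r x
  proof (cases "x = 0")
    case False
    have "(r *\<^sub>R x) /\<^sub>R norm (r *\<^sub>R x) = x /\<^sub>R norm x" using that by simp
    moreover have "norm (r *\<^sub>R x) powr p = r powr p * norm x powr p"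
      using that by (simp add: powr_mult)
    ultimately show ?thesis using False that by (simp only: Vhat_def scaleR_eq_0_iff if_False) simp
  qed (simp add: Vhat_def)
  then show ?thesis by (simp add: homogeneous_def)
qed

lemma Vhat_C1:
  fixes A :: "nat \<Rightarrow> real^'n"
  assumes "p > 1"
  shows "Ck_on 1 UNIV (Vhat p m A b w)"
  using homogeneous_C1[OF assms Vhat_homogeneous] Vhat_smooth unfolding smooth_on_def by blast

lemma Vhat_proper:
  fixes A :: "nat \<Rightarrow> real^'n"
  assumes "p > 1"
  shows "proper_fun (Vhat p m A b w)"
  unfolding proper_fun_def
proof
  fix c
  let ?S = "{x. Vhat p m A b w x \<le> c}" and ?W = "\<Sum>i<m. \<bar>w i\<bar>"
  have "Ck_on 0 UNIV (Vhat p m A b w)" 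
    using Ck_on_Suc_imp[of 0] Vhat_C1[OF assms] by (metis One_nat_def)
  then have "closed ?S" by (simp add: closed_Collect_le)
  moreover have "bounded ?S"
  proof (rule boundedI)
    fix x assume x: "x \<in> ?S"
    \<comment> \<open>This radius solves \<open>r powr p * exp (- ?W) = \<bar>c\<bar>\<close>; the
      absolute value keeps the base of \<open>powr\<close> nonnegative.\<close>
    show "norm x \<le> (\<bar>c\<bar> * exp ?W) powr (1 / p)"
    proof (cases "x = 0")
      case False
      have "norm x powr p * exp (- ?W) \<le> \<bar>c\<bar>"
        using Vhat_bounds[OF False, of p w m A b] x by force
      then have "norm x powr p \<le> \<bar>c\<bar> * exp ?W" by (simp add: exp_minus field_simps)
      then have "(norm x powr p) powr (1 / p) \<le> (\<bar>c\<bar> * exp ?W) powr (1 / p)"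
        using assms by (intro powr_mono2) auto
      then show ?thesis using assms by (simp add: powr_powr)
    qed simp
  qed
  ultimately show "compact ?S" by (simp add: compact_eq_bounded_closed)
qed

subsection \<open>Approximation on the sphere\<close>

text \<open>Both \<open>V\<close> and its approximation have the form \<open>norm y powr p * exp (N (y / norm y))\<close>, so
  on the unit sphere their jets are the same function of the jet of \<open>N\<close>.\<close>

definition sphere_jet :: "real \<Rightarrow> 'a::real_inner \<Rightarrow> real \<times> 'a \<Rightarrow> real \<times> 'a" where
  "sphere_jet p u J =
    (exp (fst J), exp (fst J) *\<^sub>R (p *\<^sub>R u + (snd J - (snd J \<bullet> u) *\<^sub>R u)))"

text \<open>At a unit vector the derivative of \<open>y /\<^sub>R norm y\<close> is the projection
  onto the tangent space, so only the tangential part of \<open>g\<close> enters; the factor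
  \<open>norm y powr p\<close> contributes the radial part \<open>p *\<^sub>R u\<close>.\<close>

lemma sphere_jet_has_derivative:
  fixes N F :: "'a::real_inner \<Rightarrow> real"
  assumes u: "norm u = 1"
    and N: "(N has_derivative (\<lambda>h. g \<bullet> h)) (at u)"
    and F: "\<And>y. y \<noteq> 0 \<Longrightarrow> F y = norm y powr p * exp (N (y /\<^sub>R norm y))"
  shows "(F has_derivative (\<lambda>h. snd (sphere_jet p u (N u, g)) \<bullet> h)) (at u)"
proof -
  have u0: "u \<noteq> 0" using u by auto
  have n: "(norm has_derivative (\<lambda>h. u \<bullet> h)) (at u)"
    using has_derivative_norm_at[OF u0] u by simp
  have "((\<lambda>y. inverse (norm y)) has_derivative (\<lambda>h. - (u \<bullet> h))) (at u)"
    using Deriv.has_derivative_inverse[OF _ n] u by simp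
  from has_derivative_scaleR[OF this has_derivative_ident]
  have "((\<lambda>y. y /\<^sub>R norm y) has_derivative (\<lambda>h. h - (u \<bullet> h) *\<^sub>R u)) (at u)"
    using u by simp
  moreover have "(N has_derivative (\<lambda>h. g \<bullet> h)) (at (u /\<^sub>R norm u))" using N u by simp
  ultimately have "((\<lambda>y. N (y /\<^sub>R norm y)) has_derivative (\<lambda>h. g \<bullet> (h - (u \<bullet> h) *\<^sub>R u))) (at u)"
    by (rule has_derivative_compose)
  from DERIV_compose_FDERIV[OF DERIV_exp this]
  have e: "((\<lambda>y. exp (N (y /\<^sub>R norm y))) has_derivative
      (\<lambda>h. (g \<bullet> (h - (u \<bullet> h) *\<^sub>R u)) * exp (N u))) (at u)"
    using u by simp
  have "((\<lambda>y. norm y powr p) has_derivative (\<lambda>h. p * (u \<bullet> h))) (at u)"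
    using has_derivative_powr[OF n has_derivative_const, of p] u by (simp add: mult.commute)
  from has_derivative_mult[OF this e]
  have "((\<lambda>y. norm y powr p * exp (N (y /\<^sub>R norm y))) has_derivative
      (\<lambda>h. snd (sphere_jet p u (N u, g)) \<bullet> h)) (at u)"
    using u by (simp add: sphere_jet_def inner_add_left inner_diff_left inner_diff_right algebra_simps)
  then show ?thesis
    by (rule has_derivative_transform_within_open[of _ _ _ _ "UNIV - {0}"])
      (use u0 F in \<open>auto simp: open_delete\<close>)
qed

lemma Vhat_sphere_jet:
  assumes "norm u = 1"
  shows "Vhat p m A b w u = fst (sphere_jet p u (tanh_net m A b w u))"
    and "(Vhat p m A b w has_derivative (\<lambda>h. snd (sphere_jet p u (tanh_net m A b w u)) \<bullet> h)) (at u)"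
proof -
  have f: "fst (tanh_net m A b w x) = (\<Sum>i<m. w i * tanh (A i \<bullet> x + b i))" for x
    by (simp add: tanh_net_def fst_sum tanh_jet_def)
  have u0: "u \<noteq> 0" using assms by auto
  then show "Vhat p m A b w u = fst (sphere_jet p u (tanh_net m A b w u))"
    using assms by (simp add: Vhat_def sphere_jet_def f)
  have tanh: "(tanh has_real_derivative 1 - (tanh y)\<^sup>2) (at y)" for y :: real
    by (auto intro!: derivative_eq_intros)
  have "((\<lambda>x. \<Sum>i<m. w i * tanh (A i \<bullet> x + b i)) has_derivative
      (\<lambda>h. \<Sum>i<m. w i * ((A i \<bullet> h) * (1 - (tanh (A i \<bullet> u + b i))\<^sup>2)))) (at u)"
  proof (intro has_derivative_sum has_derivative_mult_right DERIV_compose_FDERIV[OF tanh])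
    show "((\<lambda>x. A i \<bullet> x + b i) has_derivative (\<lambda>h. A i \<bullet> h)) (at u)" for i
      by (auto intro!: derivative_eq_intros)
  qed
  also have "(\<lambda>h. \<Sum>i<m. w i * ((A i \<bullet> h) * (1 - (tanh (A i \<bullet> u + b i))\<^sup>2)))
      = (\<lambda>h. snd (tanh_net m A b w u) \<bullet> h)"
    by (simp add: fun_eq_iff tanh_net_def snd_sum tanh_jet_def inner_sum_left mult_ac)
  finally have "((\<lambda>x. fst (tanh_net m A b w x)) has_derivative
      (\<lambda>h. snd (tanh_net m A b w u) \<bullet> h)) (at u)"
    by (simp only: f)
  moreover have "Vhat p m A b w y = norm y powr p * exp (fst (tanh_net m A b w (y /\<^sub>R norm y)))"
    if "y \<noteq> 0" for y
    using that by (simp add: Vhat_def f)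
  ultimately have "(Vhat p m A b w has_derivative (\<lambda>h. snd (sphere_jet p u
      (fst (tanh_net m A b w u), snd (tanh_net m A b w u))) \<bullet> h)) (at u)"
    by (rule sphere_jet_has_derivative[OF assms])
  then show "(Vhat p m A b w has_derivative (\<lambda>h. snd (sphere_jet p u (tanh_net m A b w u)) \<bullet> h)) (at u)"
    by simp
qed

lemma C1_gradient:
  fixes V :: "'a::euclidean_space \<Rightarrow> real"
  assumes "Ck_on 1 UNIV V"
  obtains g where "continuous_on UNIV g" "\<And>x. (V has_derivative (\<lambda>h. g x \<bullet> h)) (at x)"
proof
  define g where "g x = (\<Sum>b\<in>Basis. frechet_derivative V (at x) b *\<^sub>R b)" for x
  have c: "continuous_on UNIV (\<lambda>x. frechet_derivative V (at x) v)" for v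
    using assms by simp
  show "continuous_on UNIV g"
    unfolding g_def by (intro continuous_on_sum continuous_on_scaleR c continuous_on_const)
  fix x
  have D: "(V has_derivative frechet_derivative V (at x)) (at x)"
    using assms by (simp flip: frechet_derivative_works)
  then interpret linear "frechet_derivative V (at x)" by (rule has_derivative_linear)
  have "frechet_derivative V (at x) h = g x \<bullet> h" for h
  proof -
    have "frechet_derivative V (at x) h = frechet_derivative V (at x) (\<Sum>b\<in>Basis. (h \<bullet> b) *\<^sub>R b)"
      by (simp add: euclidean_representation)
    also have "\<dots> = g x \<bullet> h"
      by (simp add: sum scale g_def inner_sum_left inner_commute[of h] mult.commute)
    finally show ?thesis .
  qed
  then have "frechet_derivative V (at x) = (\<lambda>h. g x \<bullet> h)" by (simp add: fun_eq_iff)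
  with D show "(V has_derivative (\<lambda>h. g x \<bullet> h)) (at x)" by simp
qed

text \<open>The correction \<open>(1 - x \<bullet> x)\<^sup>2\<close> vanishes to second order on the unit sphere and makes
  the argument of the logarithm positive at the origin, so that \<open>ln V\<close> gets a \<open>C\<^sup>1\<close> extension
  to the whole space.\<close>

lemma homogeneous_sphere_jet:
  fixes V :: "'a::euclidean_space \<Rightarrow> real"
  assumes C1: "Ck_on 1 UNIV V" and pd: "positive_definite V" and hom: "homogeneous p V"
  obtains L where "C1_jet L" "\<And>u. norm u = 1 \<Longrightarrow> V u = fst (sphere_jet p u (L u))"
    "\<And>u. norm u = 1 \<Longrightarrow> (V has_derivative (\<lambda>h. snd (sphere_jet p u (L u)) \<bullet> h)) (at u)"
proof -
  obtain g where cg: "continuous_on UNIV g" and g: "\<And>x. (V has_derivative (\<lambda>h. g x \<bullet> h)) (at x)"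
    using C1_gradient[OF C1] by blast
  define Q where "Q x = V x + (1 - x \<bullet> x)\<^sup>2" for x
  have Q: "Q x > 0" for x
  proof (cases "x = 0")
    case True
    then show ?thesis using pd by (simp add: Q_def positive_definite_def)
  next
    case False
    then have "V x > 0" using pd by (simp add: positive_definite_def)
    then show ?thesis by (simp add: Q_def add_pos_nonneg)
  qed
  define G where "G x = g x - (4 * (1 - x \<bullet> x)) *\<^sub>R x" for x
  define L where "L x = (ln (Q x), inverse (Q x) *\<^sub>R G x)" for x
  have "((\<lambda>x. (1 - x \<bullet> x)\<^sup>2) has_derivative (\<lambda>h. - (4 * (1 - x \<bullet> x)) * (x \<bullet> h))) (at x)" for x :: 'a
    by (auto intro!: derivative_eq_intros simp: inner_commute algebra_simps)
  note * = has_derivative_add[OF g this]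
  have dQ: "(Q has_derivative (\<lambda>h. G x \<bullet> h)) (at x)" for x
  proof -
    have "(\<lambda>h. g x \<bullet> h + - (4 * (1 - x \<bullet> x)) * (x \<bullet> h)) = (\<lambda>h. G x \<bullet> h)"
      by (simp add: fun_eq_iff G_def inner_diff_left algebra_simps)
    with *[of x] show ?thesis by (simp only: Q_def[abs_def])
  qed
  have dL: "((\<lambda>y. fst (L y)) has_derivative (\<lambda>h. snd (L x) \<bullet> h)) (at x)" for x
    using DERIV_compose_FDERIV[OF DERIV_ln[OF Q] dQ] by (simp add: L_def mult.commute)
  have cQ: "continuous_on UNIV Q"
    using dQ by (metis has_derivative_continuous continuous_at_imp_continuous_on)
  have "continuous_on UNIV (\<lambda>x. snd (L x))"
    unfolding L_def snd_conv G_def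
  proof (intro continuous_on_scaleR continuous_on_inverse continuous_on_diff cQ cg)
    show "\<forall>x\<in>UNIV. Q x \<noteq> 0" using Q by (metis less_irrefl)
  qed (intro continuous_intros)+
  with dL have "C1_jet L" by (simp add: C1_jet_def)
  moreover have VL: "V u = exp (fst (L u))" if "norm u = 1" for u
    using Q[of u] that by (simp add: L_def Q_def dot_square_norm)
  \<comment> \<open>Equality of the values on the sphere suffices here: homogeneity extends it to
    all nonzero points, and the formula for the gradient then follows.\<close>
  moreover have "(V has_derivative (\<lambda>h. snd (sphere_jet p u (L u)) \<bullet> h)) (at u)"
    if u: "norm u = 1" for u
  proof -
    have "V y = norm y powr p * exp (fst (L (y /\<^sub>R norm y)))" if "y \<noteq> 0" for y
    proof -
      have "V (norm y *\<^sub>R (y /\<^sub>R norm y)) = norm y powr p * V (y /\<^sub>R norm y)"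
        using hom that unfolding homogeneous_def real_scaleR_def zero_less_norm_iff[symmetric] by blast
      then show ?thesis using VL[of "y /\<^sub>R norm y"] that by simp
    qed
    from sphere_jet_has_derivative[OF u dL this] show ?thesis by simp
  qed
  ultimately show thesis using that by (simp add: sphere_jet_def)
qed

text \<open>\<open>sphere_jet\<close> is jointly continuous in point and jet. The jets of
  \<open>L\<close> over the sphere are bounded, so perturbations of size at most 1 stay in a compact
  set, and uniform continuity gives one \<open>d\<close> for all \<open>u\<close>.\<close>

lemma sphere_jet_uniform:
  fixes L :: "'a::euclidean_space \<Rightarrow> real \<times> 'a"
  assumes L: "C1_jet L" and e: "e > 0"
  obtains d where "d > 0" "\<And>u J. norm u = 1 \<Longrightarrow> norm (L u - J) < d \<Longrightarrow>
    norm (sphere_jet p u J - sphere_jet p u (L u)) < e"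
proof -
  have "bounded (L ` sphere 0 1)"
    by (intro compact_imp_bounded compact_continuous_image
        continuous_on_subset[OF C1_jet_continuous[OF L]]) auto
  then obtain B where B: "\<And>u. norm u = 1 \<Longrightarrow> norm (L u) \<le> B"
    unfolding bounded_iff by fastforce
  let ?C = "sphere (0::'a) 1 \<times> cball (0 :: real \<times> 'a) (B + 1)"
  let ?f = "\<lambda>z. sphere_jet p (fst z) (snd z)"
  have "uniformly_continuous_on ?C ?f"
  proof (rule compact_uniformly_continuous)
    show "continuous_on ?C ?f" unfolding sphere_jet_def by (intro continuous_intros)
    show "compact ?C" by (intro compact_Times compact_sphere compact_cball)
  qed
  then obtain d where d: "d > 0" "\<And>z z'. z \<in> ?C \<Longrightarrow> z' \<in> ?C \<Longrightarrow> dist z' z < d \<Longrightarrow> dist (?f z') (?f z) < e"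
    using e unfolding uniformly_continuous_on_def by meson
  show thesis
  proof
    show "min d 1 > 0" using d by simp
    fix u :: 'a and J assume u: "norm u = 1" and J: "norm (L u - J) < min d 1"
    have "norm J \<le> B + 1"
      using B[OF u] J norm_triangle_sub[of J "L u"] by (simp add: norm_minus_commute)
    then have "(u, J) \<in> ?C" "(u, L u) \<in> ?C" using u B[OF u] by auto
    moreover have "dist (u, J) (u, L u) < d"
      using J by (simp add: dist_Pair_Pair dist_norm norm_minus_commute)
    ultimately have "dist (?f (u, J)) (?f (u, L u)) < e" using d(2) by blast
    then show "norm (sphere_jet p u J - sphere_jet p u (L u)) < e" by (simp add: dist_norm)
  qed
qed

lemma Vhat_C1_sphere_dense:
  fixes V :: "real^'n \<Rightarrow> real"
  assumes "Ck_on 1 UNIV V" "positive_definite V" "homogeneous p V" and e: "e > 0"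
  shows "\<exists>m\<ge>1. \<exists>(A :: nat \<Rightarrow> real^'n) b w. C1_sphere_dist (Vhat p m A b w) V < ereal e"
proof -
  obtain L where L: "C1_jet L" and V: "\<And>u. norm u = 1 \<Longrightarrow> V u = fst (sphere_jet p u (L u))"
    "\<And>u. norm u = 1 \<Longrightarrow> (V has_derivative (\<lambda>h. snd (sphere_jet p u (L u)) \<bullet> h)) (at u)"
    using homogeneous_sphere_jet[OF assms(1-3)] by blast
  \<comment> \<open>The value error and the operator norm of the derivative error are each at most
    the jet error, hence a quarter each. Their sum is then at most \<open>e / 2\<close>, and the
    slack keeps the supremum strictly below \<open>e\<close>.\<close>
  obtain d where d: "d > 0" "\<And>u J. norm u = 1 \<Longrightarrow> norm (L u - J) < d \<Longrightarrow>
    norm (sphere_jet p u J - sphere_jet p u (L u)) < e / 4"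
    using sphere_jet_uniform[OF L, of "e / 4" p] e by auto
  obtain m A b w where m: "m \<ge> 1" and N: "\<forall>u\<in>sphere 0 1. norm (L u - tanh_net m A b w u) < d"
    using tanh_net_C1_dense[OF L bounded_sphere d(1)] by blast
  have "C1_sphere_dist (Vhat p m A b w) V \<le> ereal (e / 2)"
    unfolding C1_sphere_dist_def
  proof (rule SUP_least)
    fix u :: "real^'n" assume "u \<in> sphere 0 1"
    then have u: "norm u = 1" by simp
    define J where "J = sphere_jet p u (tanh_net m A b w u)"
    define J' where "J' = sphere_jet p u (L u)"
    have JJ: "norm (J - J') < e / 4" unfolding J_def J'_def using d(2)[OF u] N u by simp
    have a: "\<bar>Vhat p m A b w u - V u\<bar> \<le> norm (J - J')"
      using norm_fst_snd_le(1)[of "J - J'"] Vhat_sphere_jet(1)[OF u, of p m A b w] V(1)[OF u]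
      by (simp add: J_def J'_def)
    have "onorm (\<lambda>h. frechet_derivative (Vhat p m A b w) (at u) h - frechet_derivative V (at u) h)
        = onorm (\<lambda>h. (snd J - snd J') \<bullet> h)"
      using frechet_derivative_eq[OF Vhat_sphere_jet(2)[OF u, of p m A b w]]
        frechet_derivative_eq[OF V(2)[OF u]]
      by (simp add: J_def J'_def inner_diff_left)
    also have "\<dots> \<le> norm (snd J - snd J')"
      by (rule onorm_le) (simp add: Cauchy_Schwarz_ineq2)
    also have "\<dots> \<le> norm (J - J')"
      using norm_fst_snd_le(2)[of "J - J'"] by simp
    finally show "ereal (\<bar>Vhat p m A b w u - V u\<bar> +
        onorm (\<lambda>h. frechet_derivative (Vhat p m A b w) (at u) h - frechet_derivative V (at u) h))
        \<le> ereal (e / 2)"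
      using a JJ by simp
  qed
  also have "\<dots> < ereal e" using e by simp
  finally show ?thesis using m by blast
qed

section \<open>Transfer of the decay estimate\<close>

lemma C1_sphere_dist_derivative:
  fixes F G :: "'a::real_normed_vector \<Rightarrow> real"
  assumes dist: "C1_sphere_dist F G < ereal e" and u: "norm u = 1"
    and F: "F differentiable (at u)" and G: "G differentiable (at u)"
  shows "frechet_derivative F (at u) h \<le> frechet_derivative G (at u) h + e * norm h"
proof -
  let ?D = "\<lambda>h. frechet_derivative F (at u) h - frechet_derivative G (at u) h"
  have "ereal (\<bar>F u - G u\<bar> + onorm ?D) \<le> C1_sphere_dist F G"
    unfolding C1_sphere_dist_def using u by (intro SUP_upper) simp
  also note dist
  finally have "onorm ?D \<le> e" by simp
  moreover have "bounded_linear ?D"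
    using F G by (intro bounded_linear_sub) (auto simp: frechet_derivative_works intro: has_derivative_bounded_linear)
  ultimately have "norm (?D h) \<le> e * norm h"
    using onorm[of ?D h] by (meson mult_right_mono norm_ge_zero order_trans)
  then show ?thesis by simp
qed

text \<open>The derivative of \<open>F\<close> has degree \<open>p - 1\<close> and, being linear in
  its direction, picks up degree \<open>d\<close> from \<open>f\<close>; the exponents add up to
  \<open>p + d - 1\<close>.\<close>

lemma homogeneous_decay:
  fixes F :: "'a::real_normed_vector \<Rightarrow> real" and f :: "'a \<Rightarrow> 'a"
  assumes F: "homogeneous p F" and f: "homogeneous d f"
    and diff: "\<And>u. norm u = 1 \<Longrightarrow> F differentiable (at u)"
    and le: "\<And>u. norm u = 1 \<Longrightarrow> frechet_derivative F (at u) (f u) \<le> - c"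
    and x: "x \<noteq> 0"
  shows "frechet_derivative F (at x) (f x) \<le> - c * norm x powr (p + d - 1)"
proof -
  define u where "u = x /\<^sub>R norm x"
  have u: "norm u = 1" "norm x > 0" "x = norm x *\<^sub>R u" using x by (auto simp: u_def)
  have D: "(F has_derivative frechet_derivative F (at u)) (at u)"
    using diff[OF u(1)] by (simp flip: frechet_derivative_works)
  have "f x = (norm x powr d) *\<^sub>R f u"
    using f u(2,3) unfolding homogeneous_def by metis
  moreover have "frechet_derivative F (at x) h = norm x powr (p - 1) * frechet_derivative F (at u) h" for h
    using frechet_derivative_eq[OF frechet_derivative_homogeneous[OF F diff[OF u(1)] u(2)]] u(3) by metis
  ultimately have "frechet_derivative F (at x) (f x)
      = norm x powr (p - 1) * (norm x powr d * frechet_derivative F (at u) (f u))"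
    using linear_cmul[OF has_derivative_linear[OF D]] by simp
  also have "\<dots> = norm x powr (p + d - 1) * frechet_derivative F (at u) (f u)"
    by (simp add: algebra_simps flip: powr_add)
  also have "\<dots> \<le> norm x powr (p + d - 1) * (- c)"
    using le[OF u(1)] by (intro mult_left_mono) auto
  finally show ?thesis by (simp add: mult.commute)
qed

theorem proposition4:
  fixes f :: "real^'n \<Rightarrow> real^'n" and V :: "real^'n \<Rightarrow> real" and p d :: real
  assumes d: "d \<ge> 1"
    and f_cont: "continuous_on UNIV f"
    and f_hom: "homogeneous d f"
    and f_las: "locally_asymptotically_stable f"
    and p: "p > 1"
    and V_C1: "Ck_on 1 UNIV V"
    and V_pd: "positive_definite V"
    and V_proper: "proper_fun V"
    and V_hom: "homogeneous p V"
  shows "(\<forall>\<epsilon>>0. \<exists>m\<ge>1. \<exists>(A :: nat \<Rightarrow> real^'n) b w.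
            C1_sphere_dist (Vhat p m A b w) V < ereal \<epsilon>)
    \<and> (\<forall>m\<ge>1. \<forall>(A :: nat \<Rightarrow> real^'n) b w.
            positive_definite (Vhat p m A b w)
          \<and> proper_fun (Vhat p m A b w)
          \<and> homogeneous p (Vhat p m A b w)
          \<and> Ck_on 1 UNIV (Vhat p m A b w)
          \<and> smooth_on (UNIV - {0}) (Vhat p m A b w)
          \<and> (\<forall>x. Vhat p m A b w x = 0 \<longleftrightarrow> x = 0))
    \<and> (\<forall>\<mu>>0. (\<forall>x. x \<noteq> 0 \<longrightarrow>
              frechet_derivative V (at x) (f x) \<le> - \<mu> * norm x powr (p + d - 1)) \<longrightarrow>
          (\<forall>\<epsilon>>0. \<exists>m\<ge>1. \<exists>(A :: nat \<Rightarrow> real^'n) b w.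
              C1_sphere_dist (Vhat p m A b w) V < ereal \<epsilon>
            \<and> (\<forall>x. x \<noteq> 0 \<longrightarrow>
                  frechet_derivative (Vhat p m A b w) (at x) (f x)
                    \<le> - (\<mu> / 2) * norm x powr (p + d - 1))))"
proof (intro conjI allI impI)
  show "\<exists>m\<ge>1. \<exists>(A :: nat \<Rightarrow> real^'n) b w. C1_sphere_dist (Vhat p m A b w) V < ereal \<epsilon>"
    if "\<epsilon> > 0" for \<epsilon>
    by (rule Vhat_C1_sphere_dense[OF V_C1 V_pd V_hom that])
next
  fix m and A :: "nat \<Rightarrow> real^'n" and b w
  show "positive_definite (Vhat p m A b w)"
    by (simp add: positive_definite_def Vhat_zero Vhat_pos)
  show "proper_fun (Vhat p m A b w)" by (rule Vhat_proper[OF p])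
  show "homogeneous p (Vhat p m A b w)" by (rule Vhat_homogeneous)
  show "Ck_on 1 UNIV (Vhat p m A b w)" by (rule Vhat_C1[OF p])
  show "smooth_on (UNIV - {0}) (Vhat p m A b w)" by (rule Vhat_smooth)
  show "Vhat p m A b w x = 0 \<longleftrightarrow> x = 0" for x
    using Vhat_pos[of x p m A b w] Vhat_zero[of p m A b w] by (cases "x = 0") auto
next
  fix \<mu> \<epsilon> :: real
  assume \<mu>: "\<mu> > 0" and \<epsilon>: "\<epsilon> > 0" and decay: "\<forall>x. x \<noteq> 0 \<longrightarrow>
    frechet_derivative V (at x) (f x) \<le> - \<mu> * norm x powr (p + d - 1)"
  have "bounded (f ` sphere 0 1)"
    by (intro compact_imp_bounded compact_continuous_image continuous_on_subset[OF f_cont]) auto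
  then obtain M where M: "M > 0" "\<And>u. norm u = 1 \<Longrightarrow> norm (f u) \<le> M"
    by (auto simp: bounded_pos)
  \<comment> \<open>On the sphere the derivative along \<open>f\<close> changes by at most
    \<open>\<eta> * M\<close>, which is at most \<open>\<mu> / 2\<close>. The minimum with
    \<epsilon> lets the same parameters meet both requirements.\<close>
  define \<eta> where "\<eta> = min \<epsilon> (\<mu> / (2 * M))"
  have \<eta>: "\<eta> > 0" using \<mu> \<epsilon> M by (simp add: \<eta>_def)
  obtain m b w and A :: "nat \<Rightarrow> real^'n"
    where m: "m \<ge> 1" and dist: "C1_sphere_dist (Vhat p m A b w) V < ereal \<eta>"
    using Vhat_C1_sphere_dense[OF V_C1 V_pd V_hom \<eta>] by blast
  have diff: "Vhat p m A b w differentiable (at u)" "V differentiable (at u)" for u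
    using V_C1 Vhat_C1[OF p, of m A b w] by simp_all
  have "C1_sphere_dist (Vhat p m A b w) V < ereal \<epsilon>"
    using dist by (rule less_le_trans) (simp add: \<eta>_def)
  moreover have "frechet_derivative (Vhat p m A b w) (at x) (f x) \<le> - (\<mu> / 2) * norm x powr (p + d - 1)"
    if "x \<noteq> 0" for x
  proof (rule homogeneous_decay[OF Vhat_homogeneous f_hom diff(1) _ that])
    fix u :: "real^'n" assume u: "norm u = 1"
    then have "u \<noteq> 0" by auto
    have "frechet_derivative (Vhat p m A b w) (at u) (f u)
        \<le> frechet_derivative V (at u) (f u) + \<eta> * norm (f u)"
      by (rule C1_sphere_dist_derivative[OF dist u diff])
    also have "\<dots> \<le> - \<mu> + \<mu> / (2 * M) * M"
    proof (rule add_mono)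
      show "frechet_derivative V (at u) (f u) \<le> - \<mu>"
        using decay \<open>u \<noteq> 0\<close> u by fastforce
      show "\<eta> * norm (f u) \<le> \<mu> / (2 * M) * M"
        using M(2)[OF u] \<eta> M(1) \<mu> by (intro mult_mono) (auto simp: \<eta>_def)
    qed
    also have "\<dots> = - (\<mu> / 2)" using M(1) by simp
    finally show "frechet_derivative (Vhat p m A b w) (at u) (f u) \<le> - (\<mu> / 2)" .
  qed
  ultimately show "\<exists>m\<ge>1. \<exists>(A :: nat \<Rightarrow> real^'n) b w. C1_sphere_dist (Vhat p m A b w) V < ereal \<epsilon>
      \<and> (\<forall>x. x \<noteq> 0 \<longrightarrow> frechet_derivative (Vhat p m A b w) (at x) (f x)
          \<le> - (\<mu> / 2) * norm x powr (p + d - 1))"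
    using m by blast
qed

end
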